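(* Let $G$ be a finite graph with $c$ connected components and first Betti number $b=\beta_1(|G|)$. Let $U_n(|G|)$ be a uniformly random $n$-vertex refinement (subdivision) of $G$. Then, asymptotically almost surely, the exterior algebraic shifting of $U_n(|G|)$ over any fixed field equals $$\Delta(|G|,n)=[n]\cup\Big\{A\in\tbinom{[n-c+1]}{2}: A\le\{2,b+2\}\Big\}.$$
   Context: A refinement of $G$ is a graph obtained by subdividing edges of $G$ by new vertices. "Asymptotically almost surely" means with probability tending to $1$ as $n\to\infty$. $[n]$ denotes the $n$ vertices, $\le$ is the lexicographic order on $2$-subsets: $A<B$ iff $\min(A\triangle B)\in A$. Exterior algebraic shifting of a complex $K$ on $[n]$ over a field of characteristic $p$: take $\mathbb F$ an extension of transcendence degree $\ge n^2$ of a base field $\mathbb F'$ of characteristic $p$, $\bigwedge K=\bigwedge\mathbb F^n/\operatorname{span}\{e_A:A\notin K\}$ with $e_A=e_{a_1}\wedge\cdots\wedge e_{a_k}$, $f_1,\dots,f_n$ a generic basis (transition matrix entries algebraically independent over $\mathbb F'$), and $\Delta(K)=\{B: \overline{f_B}\notin\operatorname{span}\{\overline{f_A}:|A|=|B|,A<B\}\}$, where $\overline{f_A}$ is the image of $f_A$ in $\bigwedge K$. *)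

theory Defs
  imports "HOL-Probability.Probability" "HOL-Library.Function_Algebras" "HOL-Library.Poly_Mapping"
begin

section \<open>Finite simple graphs and their refinements\<close>

type_synonym graph = "nat set \<times> nat set set"

definition finite_graph :: "nat set \<Rightarrow> nat set set \<Rightarrow> bool" where
  "finite_graph V E \<longleftrightarrow> finite V \<and> (\<forall>e\<in>E. e \<subseteq> V \<and> card e = 2)"

inductive refinement :: "graph \<Rightarrow> graph \<Rightarrow> bool" for G :: graph where
  refl: "refinement G G"
| subdivide: "\<lbrakk>refinement G (V, E); {u, v} \<in> E; u \<noteq> v; w \<notin> V\<rbrakk> \<Longrightarrow>
    refinement G (insert w V, (E - {{u, v}}) \<union> {{u, w}, {w, v}})"

text \<open>
  The vertices of \<open>G\<close> are kept and the new vertices get the remaining labels in \<open>[n]\<close>. As \<open>G\<close> is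
  simple, every distribution of the new vertices over the edges of \<open>G\<close> arises from the same number
  \<open>(n - |V|)!\<close> of labelled refinements, so a uniform element of this set is, up to labels, a
  uniform choice of how many new vertices each edge receives.
\<close>
definition refinements_on :: "graph \<Rightarrow> nat \<Rightarrow> graph set" where
  "refinements_on G n = {H. refinement G H \<and> fst H = {1..n}}"

definition same_component :: "nat set \<Rightarrow> nat set set \<Rightarrow> (nat \<times> nat) set" where
  "same_component V E = {(u, v). u \<in> V \<and> v \<in> V \<and> (u, v) \<in> {(x, y). {x, y} \<in> E}\<^sup>*}"

definition num_components :: "nat set \<Rightarrow> nat set set \<Rightarrow> nat" where
  "num_components V E = card (V // same_component V E)"

section \<open>Linear algebra in spaces of functions\<close>

definition fscale :: "'f::field \<Rightarrow> ('i \<Rightarrow> 'f) \<Rightarrow> 'i \<Rightarrow> 'f" where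
  "fscale a x = (\<lambda>i. a * x i)"

global_interpretation fn: vector_space "fscale :: 'f::field \<Rightarrow> ('i \<Rightarrow> 'f) \<Rightarrow> 'i \<Rightarrow> 'f"
  by unfold_locales (auto simp: fscale_def fun_eq_iff algebra_simps)

section \<open>First Betti number\<close>

text \<open>
  Simplicial homology with rational coefficients, each edge being oriented from its smaller to its
  larger endpoint. A graph has no 2-dimensional faces, so \<open>H\<^sub>1\<close> is the kernel of the
  boundary map on 1-chains.
\<close>
definition boundary1 :: "nat set set \<Rightarrow> (nat set \<Rightarrow> rat) \<Rightarrow> nat \<Rightarrow> rat" where
  "boundary1 E z v = (\<Sum>e | e \<in> E \<and> v \<in> e. if v = Max e then z e else - z e)"

definition cycles1 :: "nat set \<Rightarrow> nat set set \<Rightarrow> (nat set \<Rightarrow> rat) set" where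
  "cycles1 V E = {z. (\<forall>e. e \<notin> E \<longrightarrow> z e = 0) \<and> (\<forall>v\<in>V. boundary1 E z v = 0)}"

definition betti1 :: "nat set \<Rightarrow> nat set set \<Rightarrow> nat" where
  "betti1 V E = fn.dim (cycles1 V E)"

section \<open>Generic matrices\<close>

definition is_subfield :: "'f::field set \<Rightarrow> bool" where
  "is_subfield k \<longleftrightarrow> 0 \<in> k \<and> 1 \<in> k \<and>
     (\<forall>x\<in>k. \<forall>y\<in>k. x - y \<in> k \<and> x * y \<in> k) \<and> (\<forall>x\<in>k. inverse x \<in> k)"

definition mpoly_eval :: "('v \<Rightarrow> 'f::field) \<Rightarrow> (('v \<Rightarrow>\<^sub>0 nat) \<Rightarrow>\<^sub>0 'f) \<Rightarrow> 'f" where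
  "mpoly_eval x P = (\<Sum>m\<in>Poly_Mapping.keys P. Poly_Mapping.lookup P m *
      (\<Prod>v\<in>Poly_Mapping.keys m. x v ^ Poly_Mapping.lookup m v))"

definition alg_independent :: "'f::field set \<Rightarrow> 'v set \<Rightarrow> ('v \<Rightarrow> 'f) \<Rightarrow> bool" where
  "alg_independent k I x \<longleftrightarrow>
     (\<forall>P. (\<forall>m. Poly_Mapping.lookup P m \<in> k) \<longrightarrow>
          (\<forall>m\<in>Poly_Mapping.keys P. Poly_Mapping.keys m \<subseteq> I) \<longrightarrow>
          mpoly_eval x P = 0 \<longrightarrow> P = 0)"

definition generic_matrix :: "'f::field set \<Rightarrow> nat \<Rightarrow> (nat \<Rightarrow> nat \<Rightarrow> 'f) \<Rightarrow> bool" where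
  "generic_matrix k n X \<longleftrightarrow> alg_independent k ({1..n} \<times> {1..n}) (\<lambda>(i, j). X i j)"

section \<open>Exterior algebra\<close>

text \<open>
  An element of the exterior algebra of \<open>F\<^sup>n\<close> is given by its coordinates with respect to the
  basis \<open>e\<^sub>A\<close>, \<open>A \<subseteq> [n]\<close>. Since \<open>e\<^sub>A \<and> e\<^sub>B\<close> is zero unless \<open>A\<close> and \<open>B\<close>
  are disjoint, and otherwise is \<open>e\<^bsub>A \<union> B\<^esub>\<close> up to the sign of the sorting permutation,
  only the pairs \<open>(A, C - A)\<close> contribute to the coordinate at \<open>C\<close> of a product.
\<close>
type_synonym 'f ext = "nat set \<Rightarrow> 'f"

definition e_base :: "nat set \<Rightarrow> 'f::field ext" where
  "e_base A = (\<lambda>B. if B = A then 1 else 0)"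

definition wedge_sign :: "nat set \<Rightarrow> nat set \<Rightarrow> 'f::field" where
  "wedge_sign A B = (-1) ^ card {(a, b). a \<in> A \<and> b \<in> B \<and> b < a}"

definition wedge :: "'f::field ext \<Rightarrow> 'f ext \<Rightarrow> 'f ext" where
  "wedge x y = (\<lambda>C. \<Sum>A\<in>Pow C. wedge_sign A (C - A) * x A * y (C - A))"

definition f_vec :: "nat \<Rightarrow> (nat \<Rightarrow> nat \<Rightarrow> 'f::field) \<Rightarrow> nat \<Rightarrow> 'f ext" where
  "f_vec n X i = (\<Sum>j\<in>{1..n}. fscale (X i j) (e_base {j}))"

definition f_base :: "nat \<Rightarrow> (nat \<Rightarrow> nat \<Rightarrow> 'f::field) \<Rightarrow> nat set \<Rightarrow> 'f ext" where
  "f_base n X B = foldr wedge (map (f_vec n X) (sorted_list_of_set B)) (e_base {})"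

section \<open>Exterior algebraic shifting\<close>

definition lex_less :: "nat set \<Rightarrow> nat set \<Rightarrow> bool" where
  "lex_less A B \<longleftrightarrow> A \<noteq> B \<and> Min ((A - B) \<union> (B - A)) \<in> A"

text \<open>
  In the quotient of the exterior algebra by \<open>W = span {e\<^sub>A. A \<notin> K}\<close>, the class of \<open>x\<close> lies in
  the span of the classes of the elements of \<open>S\<close> iff \<open>x\<close> is congruent modulo \<open>W\<close> to some
  element of the span of \<open>S\<close>.
\<close>
definition in_quotient_span :: "nat \<Rightarrow> nat set set \<Rightarrow> 'f::field ext \<Rightarrow> 'f ext set \<Rightarrow> bool" where
  "in_quotient_span n K x S \<longleftrightarrow>
     (\<exists>s\<in>fn.span S. x - s \<in> fn.span {e_base A | A. A \<subseteq> {1..n} \<and> A \<notin> K})"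

definition exterior_shifting ::
    "nat \<Rightarrow> (nat \<Rightarrow> nat \<Rightarrow> 'f::field) \<Rightarrow> nat set set \<Rightarrow> nat set set" where
  "exterior_shifting n X K = {B. B \<subseteq> {1..n} \<and>
     \<not> in_quotient_span n K (f_base n X B)
         {f_base n X A | A. A \<subseteq> {1..n} \<and> card A = card B \<and> lex_less A B}}"

definition graph_complex :: "graph \<Rightarrow> nat set set" where
  "graph_complex H = {{}} \<union> {{v} | v. v \<in> fst H} \<union> snd H"

text \<open>
  Comparison of a 2-subset with the pair \<open>i \<le> j\<close>. In the bound \<open>{2, b + 2}\<close> the pair
  degenerates for \<open>b = 0\<close>; comparing sorted pairs then admits exactly the sets \<open>{1, j}\<close>, whereas
  the symmetric-difference order applied to the singleton \<open>{2, 2} = {2}\<close> would admit every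
  \<open>{2, j}\<close> as well.
\<close>
definition lex_le_pair :: "nat set \<Rightarrow> nat \<Rightarrow> nat \<Rightarrow> bool" where
  "lex_le_pair A i j \<longleftrightarrow> Min A < i \<or> (Min A = i \<and> Max A \<le> j)"

lemma lex_le_pair_iff:
  assumes "card A = 2" and "i < j"
  shows "lex_le_pair A i j \<longleftrightarrow> A = {i, j} \<or> lex_less A {i, j}"
proof -
  obtain a b where A: "A = {a, b}" "a < b"
    using assms(1) unfolding card_2_iff by (metis insert_commute linorder_neqE_nat)
  have mm: "Min A = a" "Max A = b" using A by auto
  consider "a < i" | "a = i" "b < j" | "a = i" "b = j" | "a = i" "b > j" | "a > i" by linarith
  then show ?thesis
  proof cases
    case 1
    have "Min ((A - {i, j}) \<union> ({i, j} - A)) = a"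
      by (rule Min_eqI) (use 1 A assms in auto)
    then show ?thesis using 1 A mm assms by (auto simp: lex_le_pair_def lex_less_def)
  next
    case 2
    have "(A - {i, j}) \<union> ({i, j} - A) = {b, j}" using 2 A assms by auto
    then show ?thesis using 2 A mm assms by (auto simp: lex_le_pair_def lex_less_def)
  next
    case 3
    then show ?thesis using A mm by (auto simp: lex_le_pair_def)
  next
    case 4
    have "(A - {i, j}) \<union> ({i, j} - A) = {b, j}" using 4 A assms by auto
    then show ?thesis using 4 A mm assms
      by (auto simp: lex_le_pair_def lex_less_def doubleton_eq_iff)
  next
    case 5
    have "Min ((A - {i, j}) \<union> ({i, j} - A)) = i"
      by (rule Min_eqI) (use 5 A assms in auto)
    then show ?thesis using 5 A mm assms
      by (auto simp: lex_le_pair_def lex_less_def doubleton_eq_iff)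
  qed
qed

text \<open>
  The vertices \<open>[n]\<close> enter as singletons, and the empty face is listed because
  \<^const>\<open>graph_complex\<close> and hence \<^const>\<open>exterior_shifting\<close> contain it.
\<close>
definition Delta_top :: "nat \<Rightarrow> nat \<Rightarrow> nat \<Rightarrow> nat set set" where
  "Delta_top b c n = {{}} \<union> {{v} | v. v \<in> {1..n}} \<union>
     {A. A \<subseteq> {1..n - c + 1} \<and> card A = 2 \<and> lex_le_pair A 2 (b + 2)}"

end

theory Submission
  imports Defs "Jordan_Normal_Form.Determinant"
begin

text \<open>
  A random refinement arises by repeatedly subdividing a uniformly random edge, so an edge of \<open>G\<close>
  survives all \<open>n\<close> subdivisions with probability \<open>O(1/n)\<close>. Asymptotically almost surely every
  edge of the refinement \<open>H\<close> therefore has an endpoint of degree 2 that is a new vertex.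

  For such \<open>H\<close> consider edge weights \<open>z\<close> as antisymmetric matrices supported on \<open>H\<close>. The
  products \<open>f\<^sub>1 \<and> v\<close> span a space of dimension \<open>n - c\<close> in the quotient, so it suffices
  that \<open>f\<^sub>1 \<and> f\<^sub>j\<close> for \<open>2 \<le> j \<le> n - c + 1\<close> and \<open>f\<^sub>2 \<and> f\<^sub>j\<close> for \<open>3 \<le> j \<le> b + 2\<close>
  form a basis of it. This is the nonvanishing of a determinant, hence it can be checked at one
  specialisation of the generic matrix. Take \<open>f\<^sub>1 = 1\<close> and \<open>f\<^sub>2 = y\<close> with distinct entries: the
  weights with \<open>z f\<^sub>1 = 0\<close> form the \<open>b\<close>-dimensional cycle space, on which \<open>z \<mapsto> z f\<^sub>2\<close> is injective
  because an edge at a vertex of degree 2 is killed by the two equations at that vertex. The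
  remaining \<open>f\<^sub>j\<close> are chosen one by one so that each cuts the dimensions of \<open>{z f\<^sub>1. z f\<^sub>1 \<bottom> f\<^sub>2}\<close>
  and of \<open>{z f\<^sub>2. z f\<^sub>1 = 0}\<close> by one until both are zero.
\<close>

section \<open>Polynomial functions and generic points\<close>

text \<open>A refinement has the same \<open>b\<close> and \<open>c\<close> as \<open>G\<close>,
  hence \<open>n - c + b\<close> edges, and the claimed pairs number \<open>(n - c) + b\<close> as
  well. Their products are therefore a basis of the functions on the edges as soon as they are
  linearly independent, and every pair that comes after all of them is spanned automatically. The
  obstacle is that one vector \<open>f\<^sub>j\<close> enters a product with
  \<open>f\<^sub>1\<close> and a product with \<open>f\<^sub>2\<close>, so the remaining vectors
  have to cut two spaces simultaneously. This is possible because two proper subspaces never cover a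
  vector space, over any field, and because \<open>b \<le> n - c - 1\<close> for large
  \<open>n\<close>: the smaller space is exhausted after \<open>b\<close> vectors, the last of which
  is \<open>f\<^sub>j\<close> with \<open>j = b + 2\<close>. This is where the bound
  \<open>{2, b + 2}\<close> comes from. On the random side, the labels of the new vertices say
  nothing about the order of the subdivisions. Exchanging consecutive subdivisions shows that the
  largest label can be taken as the last one inserted, which turns the count of refinements into a
  recursion on \<open>n\<close>.\<close>

definition polyfun :: "'f::field set \<Rightarrow> 'v set \<Rightarrow> (('v \<Rightarrow> 'f) \<Rightarrow> 'f) \<Rightarrow> bool" where
  "polyfun k I g \<longleftrightarrow> (\<exists>P. (\<forall>m. Poly_Mapping.lookup P m \<in> k) \<and>
     (\<forall>m\<in>Poly_Mapping.keys P. Poly_Mapping.keys m \<subseteq> I) \<and> (\<forall>x. mpoly_eval x P = g x))"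

definition monom_eval :: "('v \<Rightarrow> 'f::field) \<Rightarrow> ('v \<Rightarrow>\<^sub>0 nat) \<Rightarrow> 'f" where
  "monom_eval x m = (\<Prod>v\<in>Poly_Mapping.keys m. x v ^ Poly_Mapping.lookup m v)"

lemma monom_eval_superset:
  assumes "finite J" "Poly_Mapping.keys m \<subseteq> J"
  shows "monom_eval x m = (\<Prod>v\<in>J. x v ^ Poly_Mapping.lookup m v)"
  unfolding monom_eval_def
  by (rule prod.mono_neutral_left) (use assms in \<open>auto simp: in_keys_iff\<close>)

lemma monom_eval_add: "monom_eval x (m + m') = monom_eval x m * monom_eval x m'"
proof -
  let ?J = "Poly_Mapping.keys m \<union> Poly_Mapping.keys m'"
  have "Poly_Mapping.keys (m + m') \<subseteq> ?J" by (rule keys_add)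
  then have "monom_eval x (m + m') = (\<Prod>v\<in>?J. x v ^ Poly_Mapping.lookup (m + m') v)"
    by (intro monom_eval_superset) auto
  also have "\<dots> = (\<Prod>v\<in>?J. x v ^ Poly_Mapping.lookup m v) * (\<Prod>v\<in>?J. x v ^ Poly_Mapping.lookup m' v)"
    by (simp add: lookup_add power_add prod.distrib)
  also have "\<dots> = monom_eval x m * monom_eval x m'"
    by (simp add: monom_eval_superset[of ?J])
  finally show ?thesis .
qed

lemma mpoly_eval_superset:
  assumes "finite J" "Poly_Mapping.keys P \<subseteq> J"
  shows "mpoly_eval x P = (\<Sum>m\<in>J. Poly_Mapping.lookup P m * monom_eval x m)"
  unfolding mpoly_eval_def monom_eval_def
  by (rule sum.mono_neutral_left) (use assms in \<open>auto simp: in_keys_iff\<close>)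

lemma mpoly_eval_add: "mpoly_eval x (P + Q) = mpoly_eval x P + mpoly_eval x Q"
proof -
  let ?J = "Poly_Mapping.keys P \<union> Poly_Mapping.keys Q"
  have "Poly_Mapping.keys (P + Q) \<subseteq> ?J" by (rule keys_add)
  then show ?thesis
    by (simp add: mpoly_eval_superset[of ?J] lookup_add algebra_simps sum.distrib)
qed

context
  fixes k :: "'f::field set" and I :: "'v set"
  assumes k: "is_subfield k"
begin

lemma subfield_add: "x \<in> k \<Longrightarrow> y \<in> k \<Longrightarrow> x + y \<in> k"
proof -
  assume "x \<in> k" "y \<in> k"
  then have "x - (0 - y) \<in> k" using k unfolding is_subfield_def by blast
  then show ?thesis by simp
qed

lemma subfield_uminus: "x \<in> k \<Longrightarrow> - x \<in> k"
  using k unfolding is_subfield_def by (metis diff_0)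

lemma polyfun_monom:
  assumes "a \<in> k" "Poly_Mapping.keys m \<subseteq> I"
  shows "polyfun k I (\<lambda>x. a * monom_eval x m)"
  unfolding polyfun_def
proof (intro exI[of _ "Poly_Mapping.single m a"] conjI allI)
  show "Poly_Mapping.lookup (Poly_Mapping.single m a) m' \<in> k" for m'
    using assms k by (auto simp: lookup_single is_subfield_def when_def)
  show "\<forall>m\<in>Poly_Mapping.keys (Poly_Mapping.single m a). Poly_Mapping.keys m \<subseteq> I"
    using assms by (auto split: if_splits)
  show "mpoly_eval x (Poly_Mapping.single m a) = a * monom_eval x m" for x
    by (subst mpoly_eval_superset[of "{m}"]) (auto split: if_splits)
qed

lemma polyfun_const: "a \<in> k \<Longrightarrow> polyfun k I (\<lambda>x. a)"
  using polyfun_monom[of a 0] by (simp add: monom_eval_def)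

lemma polyfun_var: "v \<in> I \<Longrightarrow> polyfun k I (\<lambda>x. x v)"
  using polyfun_monom[of 1 "Poly_Mapping.single v 1"] k by (simp add: monom_eval_def is_subfield_def)

lemma polyfun_add:
  assumes "polyfun k I g" "polyfun k I h"
  shows "polyfun k I (\<lambda>x. g x + h x)"
proof -
  from assms obtain P Q where
    "\<forall>m. Poly_Mapping.lookup P m \<in> k" "\<forall>m\<in>Poly_Mapping.keys P. Poly_Mapping.keys m \<subseteq> I"
    "\<forall>x. mpoly_eval x P = g x"
    "\<forall>m. Poly_Mapping.lookup Q m \<in> k" "\<forall>m\<in>Poly_Mapping.keys Q. Poly_Mapping.keys m \<subseteq> I"
    "\<forall>x. mpoly_eval x Q = h x" unfolding polyfun_def by blast
  moreover from this have "Poly_Mapping.keys m \<subseteq> I" if "m \<in> Poly_Mapping.keys (P + Q)" for m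
    using that keys_add[of P Q] by blast
  ultimately show ?thesis unfolding polyfun_def
    by (intro exI[of _ "P + Q"]) (simp add: lookup_add mpoly_eval_add subfield_add)
qed

lemma polyfun_sum:
  assumes "\<And>a. a \<in> A \<Longrightarrow> polyfun k I (g a)"
  shows "polyfun k I (\<lambda>x. \<Sum>a\<in>A. g a x)"
  using assms
proof (induction A rule: infinite_finite_induct)
  case (insert a A)
  then show ?case by (simp add: polyfun_add)
qed (use k in \<open>auto simp: is_subfield_def intro: polyfun_const\<close>)

lemma polyfun_mult:
  assumes "polyfun k I g" "polyfun k I h"
  shows "polyfun k I (\<lambda>x. g x * h x)"
proof -
  from assms obtain P Q where PQ:
    "\<forall>m. Poly_Mapping.lookup P m \<in> k" "\<forall>m\<in>Poly_Mapping.keys P. Poly_Mapping.keys m \<subseteq> I"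
    "\<forall>x. mpoly_eval x P = g x"
    "\<forall>m. Poly_Mapping.lookup Q m \<in> k" "\<forall>m\<in>Poly_Mapping.keys Q. Poly_Mapping.keys m \<subseteq> I"
    "\<forall>x. mpoly_eval x Q = h x" unfolding polyfun_def by blast
  have "g x * h x = (\<Sum>m\<in>Poly_Mapping.keys P. \<Sum>m'\<in>Poly_Mapping.keys Q.
      (Poly_Mapping.lookup P m * Poly_Mapping.lookup Q m') * monom_eval x (m + m'))" for x
  proof -
    have "g x * h x = mpoly_eval x P * mpoly_eval x Q" using PQ by simp
    also have "\<dots> = (\<Sum>m\<in>Poly_Mapping.keys P. \<Sum>m'\<in>Poly_Mapping.keys Q.
      (Poly_Mapping.lookup P m * monom_eval x m) * (Poly_Mapping.lookup Q m' * monom_eval x m'))"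
      by (simp add: mpoly_eval_def monom_eval_def sum_product)
    finally show ?thesis by (simp only: monom_eval_add mult_ac)
  qed
  moreover have "polyfun k I (\<lambda>x. \<Sum>m\<in>Poly_Mapping.keys P. \<Sum>m'\<in>Poly_Mapping.keys Q.
      (Poly_Mapping.lookup P m * Poly_Mapping.lookup Q m') * monom_eval x (m + m'))"
  proof (rule polyfun_sum, rule polyfun_sum, rule polyfun_monom)
    fix m m' assume m: "m \<in> Poly_Mapping.keys P" "m' \<in> Poly_Mapping.keys Q"
    then have "Poly_Mapping.keys m \<union> Poly_Mapping.keys m' \<subseteq> I" using PQ(2,5) by blast
    then show "Poly_Mapping.keys (m + m') \<subseteq> I" using keys_add[of m m'] by (rule order.trans[rotated])
    show "Poly_Mapping.lookup P m * Poly_Mapping.lookup Q m' \<in> k"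
      using PQ(1,4) k unfolding is_subfield_def by blast
  qed
  ultimately show ?thesis by simp
qed

lemma polyfun_prod:
  assumes "\<And>a. a \<in> A \<Longrightarrow> polyfun k I (g a)"
  shows "polyfun k I (\<lambda>x. \<Prod>a\<in>A. g a x)"
  using assms
proof (induction A rule: infinite_finite_induct)
  case (insert a A)
  then show ?case by (simp add: polyfun_mult)
qed (use k in \<open>auto simp: is_subfield_def intro: polyfun_const\<close>)

lemma polyfun_diff:
  assumes "polyfun k I g" "polyfun k I h"
  shows "polyfun k I (\<lambda>x. g x - h x)"
proof -
  have "polyfun k I (\<lambda>x. - 1 * h x)"
    using assms k by (intro polyfun_mult polyfun_const subfield_uminus) (auto simp: is_subfield_def)
  from polyfun_add[OF assms(1) this] show ?thesis by simp
qed

text \<open>A polynomial function need not determine its polynomial, but one nonzero value shows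
  that the polynomial is not zero. The point \<open>x0\<close> ranges over the whole field, so its
  coordinates may even be entries of \<open>X\<close>.\<close>

lemma alg_independent_nonzero:
  assumes "alg_independent k I X" "polyfun k I g" "g x0 \<noteq> 0"
  shows "g X \<noteq> 0"
proof
  assume 0: "g X = 0"
  obtain P where P: "\<forall>m. Poly_Mapping.lookup P m \<in> k"
    "\<forall>m\<in>Poly_Mapping.keys P. Poly_Mapping.keys m \<subseteq> I" "\<forall>x. mpoly_eval x P = g x"
    using assms(2) unfolding polyfun_def by blast
  have "mpoly_eval X P = 0" using P(3) 0 by simp
  then have "P = 0" using assms(1) P(1,2) unfolding alg_independent_def by blast
  then have "mpoly_eval x0 P = 0" by (simp add: mpoly_eval_def)
  then have "g x0 = 0" using P(3) by simp
  then show False using assms(3) by simp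
qed

text \<open>The matrix \<open>w d t\<close> is square and its determinant is a polynomial function.
  A trivial kernel on the \<open>T\<close> side at \<open>x0\<close> makes it nonzero there, hence
  nonzero at \<open>X\<close>, and transposition moves the conclusion to the \<open>D\<close> side.
  The change of sides fits the use: at the special point one kills an edge weight, at the generic
  point one wants independence of products.\<close>

lemma alg_independent_kernel:
  fixes w :: "'d \<Rightarrow> 't \<Rightarrow> ('v \<Rightarrow> 'f) \<Rightarrow> 'f"
  assumes fin: "finite D" "finite T" and card: "card D = card T"
    and poly: "\<And>d t. d \<in> D \<Longrightarrow> t \<in> T \<Longrightarrow> polyfun k I (w d t)"
    and X: "alg_independent k I X"
    and left: "\<And>z t. (\<And>d. d \<in> D \<Longrightarrow> (\<Sum>t\<in>T. z t * w d t x0) = 0) \<Longrightarrow> t \<in> T \<Longrightarrow> z t = 0"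
    and right: "\<And>t. t \<in> T \<Longrightarrow> (\<Sum>d\<in>D. a d * w d t X) = 0" and "d \<in> D"
  shows "a d = 0"
proof -
  define m where "m = card D"
  obtain \<delta> where \<delta>: "bij_betw \<delta> {0..<m} D"
    using ex_bij_betw_nat_finite[OF fin(1)] unfolding m_def by blast
  obtain \<tau> where \<tau>: "bij_betw \<tau> {0..<m} T"
    using ex_bij_betw_nat_finite[OF fin(2)] unfolding m_def card by blast
  define M where "M x = mat m m (\<lambda>(i, j). w (\<delta> i) (\<tau> j) x)" for x
  have M: "M x \<in> carrier_mat m m" for x by (simp add: M_def)
  have \<delta>D: "\<delta> i \<in> D" if "i < m" for i using that \<delta> by (auto simp: bij_betw_def)
  have \<tau>T: "\<tau> i \<in> T" if "i < m" for i using that \<tau> by (auto simp: bij_betw_def)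
  have row: "vec_index (M x *\<^sub>v v) i = (\<Sum>t\<in>T. vec_index v (inv_into {0..<m} \<tau> t) * w (\<delta> i) t x)"
    if v: "v \<in> carrier_vec m" and i: "i < m" for x v i
  proof -
    have "vec_index (M x *\<^sub>v v) i = (\<Sum>j\<in>{0..<m}. w (\<delta> i) (\<tau> j) x * vec_index v j)"
      using v i by (simp add: M_def scalar_prod_def)
    also have "\<dots> = (\<Sum>t\<in>T. vec_index v (inv_into {0..<m} \<tau> t) * w (\<delta> i) t x)"
      by (subst sum.reindex_bij_betw[OF \<tau>, symmetric], rule sum.cong)
        (use \<tau> in \<open>auto simp: bij_betw_def inv_into_f_f\<close>)
    finally show ?thesis .
  qed
  have "Determinant.det (M x0) \<noteq> 0"
  proof
    assume "Determinant.det (M x0) = 0"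
    then obtain v where v: "v \<in> carrier_vec m" "v \<noteq> 0\<^sub>v m" "M x0 *\<^sub>v v = 0\<^sub>v m"
      using det_0_iff_vec_prod_zero[OF M] by blast
    have "vec_index v i = 0" if i: "i < m" for i
    proof -
      have "vec_index v (inv_into {0..<m} \<tau> (\<tau> i)) = 0"
      proof (rule left[of "\<lambda>t. vec_index v (inv_into {0..<m} \<tau> t)"])
        fix d assume "d \<in> D"
        then obtain i' where "i' < m" "d = \<delta> i'" using \<delta> by (auto simp: bij_betw_def)
        then show "(\<Sum>t\<in>T. vec_index v (inv_into {0..<m} \<tau> t) * w d t x0) = 0"
          using row[OF v(1), of i' x0] v(3) by simp
      qed (use i \<tau>T in auto)
      then show ?thesis using i \<tau> by (simp add: bij_betw_def inv_into_f_f)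
    qed
    then show False using v(1,2) by auto
  qed
  moreover have "polyfun k I (\<lambda>x. Determinant.det (M x))"
  proof -
    have eq: "Determinant.det (M x) = (\<Sum>p | p permutes {0..<m}. signof p * (\<Prod>i=0..<m. w (\<delta> i) (\<tau> (p i)) x))" for x
      unfolding det_def'[OF M]
    proof (rule sum.cong)
      fix p assume "p \<in> {p. p permutes {0..<m}}"
      then have "p i < m" if "i < m" for i using that by (auto simp: permutes_in_image)
      then have "(\<Prod>i=0..<m. M x $$ (i, p i)) = (\<Prod>i=0..<m. w (\<delta> i) (\<tau> (p i)) x)"
        by (intro prod.cong) (auto simp: M_def)
      then show "signof p * (\<Prod>i=0..<m. M x $$ (i, p i)) =
          signof p * (\<Prod>i=0..<m. w (\<delta> i) (\<tau> (p i)) x)" by simp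
    qed simp
    have "(signof p :: 'f) \<in> k" for p :: "nat \<Rightarrow> nat"
      using k subfield_uminus[of 1] by (auto simp: is_subfield_def sign_def)
    then show ?thesis unfolding eq
      by (intro polyfun_sum polyfun_mult polyfun_prod polyfun_const poly)
        (auto intro!: \<delta>D \<tau>T simp: permutes_in_image)
  qed
  ultimately have "Determinant.det (M X) \<noteq> 0"
    using alg_independent_nonzero[OF X, of "\<lambda>x. Determinant.det (M x)" x0] by blast
  then have "Determinant.det (transpose_mat (M X)) \<noteq> 0" by (simp add: det_transpose[OF M])
  moreover define v where "v = Matrix.vec m (\<lambda>i. a (\<delta> i))"
  have "transpose_mat (M X) *\<^sub>v v = 0\<^sub>v m"
  proof
    fix j assume "j < dim_vec (0\<^sub>v m :: 'f Matrix.vec)"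
    then have j: "j < m" by simp
    have "vec_index (transpose_mat (M X) *\<^sub>v v) j = (\<Sum>i\<in>{0..<m}. w (\<delta> i) (\<tau> j) X * a (\<delta> i))"
      using j by (simp add: M_def scalar_prod_def v_def)
    also have "\<dots> = (\<Sum>d\<in>D. w d (\<tau> j) X * a d)"
      by (rule sum.reindex_bij_betw[OF \<delta>])
    also have "\<dots> = 0" using right[OF \<tau>T[OF j]] by (simp add: mult.commute)
    finally show "vec_index (transpose_mat (M X) *\<^sub>v v) j = vec_index (0\<^sub>v m) j" using j by simp
  qed (simp add: M_def)
  ultimately have "v = 0\<^sub>v m"
    using det_0_iff_vec_prod_zero[of "transpose_mat (M X)" m] M[of X] transpose_carrier_mat vec_carrier
    unfolding v_def by metis
  moreover obtain i where "i < m" "d = \<delta> i" using \<open>d \<in> D\<close> \<delta> by (auto simp: bij_betw_def)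
  ultimately show ?thesis by (metis index_vec index_zero_vec(1) v_def)
qed

end

section \<open>Components and cycle spaces\<close>

definition conn :: "nat set set \<Rightarrow> (nat \<times> nat) set" where
  "conn E = {(x, y). {x, y} \<in> E}\<^sup>*"

text \<open>A choice of one vertex in each component. Explicit representatives are easier to follow
  through the insertion of edges and vertices than quotient sets, and they index bases later
  on.\<close>

definition component_rep :: "nat set \<Rightarrow> nat set set \<Rightarrow> (nat \<Rightarrow> nat) \<Rightarrow> bool" where
  "component_rep V E r \<longleftrightarrow> r ` V \<subseteq> V \<and> (\<forall>x y. {x, y} \<in> E \<longrightarrow> r x = r y) \<and> (\<forall>x\<in>V. (x, r x) \<in> conn E)"

lemma conn_sym: "(x, y) \<in> conn E \<Longrightarrow> (y, x) \<in> conn E"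
proof -
  have "sym {(x, y). {x, y} \<in> E}" by (auto simp: sym_def insert_commute)
  then have "sym (conn E)" unfolding conn_def by (rule sym_rtrancl)
  then show "(x, y) \<in> conn E \<Longrightarrow> (y, x) \<in> conn E" by (simp add: sym_def)
qed

lemma conn_trans: "(x, y) \<in> conn E \<Longrightarrow> (y, z) \<in> conn E \<Longrightarrow> (x, z) \<in> conn E"
  unfolding conn_def by (rule rtrancl_trans)

lemma conn_refl: "(x, x) \<in> conn E"
  unfolding conn_def by simp

lemma conn_edge: "{x, y} \<in> E \<Longrightarrow> (x, y) \<in> conn E"
  unfolding conn_def by auto

lemma conn_subset: "(\<And>x y. {x, y} \<in> E \<Longrightarrow> (x, y) \<in> conn E') \<Longrightarrow> conn E \<subseteq> conn E'"
  unfolding conn_def by (rule rtrancl_subset_rtrancl) auto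

lemma component_rep_conn:
  assumes "component_rep V E r" "(x, y) \<in> conn E"
  shows "r x = r y"
  using assms(2) unfolding conn_def
  by (induction rule: rtrancl_induct) (use assms(1) in \<open>auto simp: component_rep_def\<close>)

lemma component_rep_eq_iff:
  assumes "component_rep V E r" "x \<in> V" "y \<in> V"
  shows "r x = r y \<longleftrightarrow> (x, y) \<in> conn E"
  using assms component_rep_conn[OF assms(1)] conn_sym conn_trans
  unfolding component_rep_def by metis

lemma component_rep_idem:
  assumes "component_rep V E r" "x \<in> V"
  shows "r (r x) = r x"
  using assms component_rep_conn[OF assms(1), of x "r x"] unfolding component_rep_def by auto

lemma num_components_eq:
  assumes "component_rep V E r"
  shows "num_components V E = card (r ` V)"
proof -
  have sc: "same_component V E `` {x} = {y\<in>V. r x = r y}" if "x \<in> V" for x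
    using component_rep_eq_iff[OF assms that] that unfolding same_component_def conn_def by auto
  have "V // same_component V E = (\<lambda>a. {y\<in>V. a = r y}) ` r ` V"
    unfolding quotient_def using sc by (auto simp: image_iff)
  moreover have "inj_on (\<lambda>a. {y\<in>V. a = r y}) (r ` V)"
    by (auto simp: inj_on_def)
  ultimately show ?thesis unfolding num_components_def by (simp add: card_image)
qed

section \<open>Edge weights as antisymmetric matrices\<close>

text \<open>The pairing of an edge weight \<open>z\<close> with \<open>f \<and> g\<close>.\<close>
definition pairing :: "nat set set \<Rightarrow> (nat set \<Rightarrow> 'f::field) \<Rightarrow> (nat \<Rightarrow> 'f) \<Rightarrow> (nat \<Rightarrow> 'f) \<Rightarrow> 'f" where
  "pairing E z f g = (\<Sum>e\<in>E. z e * (f (Min e) * g (Max e) - f (Max e) * g (Min e)))"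

definition delta :: "nat \<Rightarrow> nat \<Rightarrow> 'f::field" where
  "delta v = (\<lambda>i. if i = v then 1 else 0)"

text \<open>The coordinate at \<open>v\<close> of the antisymmetric matrix of \<open>z\<close>
  applied to \<open>f\<close>. For the constant vector 1 this is the simplicial boundary of
  \<open>z\<close>.\<close>

definition contract :: "nat set set \<Rightarrow> (nat set \<Rightarrow> 'f::field) \<Rightarrow> (nat \<Rightarrow> 'f) \<Rightarrow> nat \<Rightarrow> 'f" where
  "contract E z f v = pairing E z f (delta v)"

definition edge_fun :: "nat set \<Rightarrow> nat set \<Rightarrow> 'f::field" where
  "edge_fun e = (\<lambda>e'. if e' = e then 1 else 0)"

text \<open>Cycles over the field of the exterior algebra, whereas \<open>cycles1\<close> is
  rational. Asking for a zero boundary at all \<open>v\<close> is harmless, as the boundary vanishes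
  off the vertex set.\<close>

definition cycle_space :: "nat set set \<Rightarrow> (nat set \<Rightarrow> 'f::field) set" where
  "cycle_space E = {z. (\<forall>e. e \<notin> E \<longrightarrow> z e = 0) \<and> (\<forall>v. contract E z (\<lambda>_. 1) v = 0)}"

lemma finite_graph_edge:
  assumes "finite_graph V E" "e \<in> E"
  shows "Min e \<in> V" "Max e \<in> V" "Min e < Max e" "e = {Min e, Max e}" "finite e"
proof -
  obtain a b where "e = {a, b}" "a \<noteq> b" "e \<subseteq> V"
    using assms unfolding finite_graph_def card_2_iff by metis
  then show "Min e \<in> V" "Max e \<in> V" "Min e < Max e" "e = {Min e, Max e}" "finite e"
    by (auto simp: min_def max_def)
qed

lemma finite_graph_finite: "finite_graph V E \<Longrightarrow> finite E"
  unfolding finite_graph_def by (meson Pow_iff finite_Pow_iff finite_subset subsetI)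

lemma fscale_apply: "fscale a z i = a * z i"
  by (simp add: fscale_def)

lemma sum_fun_apply: "(\<Sum>a\<in>A. g a) x = (\<Sum>a\<in>A. g a x)"
  by (induction A rule: infinite_finite_induct) auto

lemma pairing_add: "pairing E (z + z') f g = pairing E z f g + pairing E z' f g"
  by (simp add: pairing_def distrib_right sum.distrib)

lemma pairing_scale: "pairing E (fscale a z) f g = a * pairing E z f g"
  by (simp add: pairing_def fscale_def sum_distrib_left algebra_simps)

lemma contract_add: "contract E (z + z') f = contract E z f + contract E z' f"
  by (simp add: contract_def pairing_add fun_eq_iff)

lemma contract_scale: "contract E (fscale a z) f = fscale a (contract E z f)"
  by (simp add: fun_eq_iff fscale_apply contract_def pairing_scale)

text \<open>With \<open>f\<close> fixed, a pairing is the scalar product of \<open>g\<close> with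
  the single vector \<open>contract E z f\<close>. Vanishing pairings thus become orthogonality
  conditions on that vector.\<close>

lemma pairing_eq_sum_contract:
  assumes "finite_graph V E"
  shows "pairing E z f g = (\<Sum>v\<in>V. contract E z f v * g v)"
proof -
  have fV: "finite V" using assms by (simp add: finite_graph_def)
  have "(\<Sum>v\<in>V. contract E z f v * g v) =
     (\<Sum>e\<in>E. \<Sum>v\<in>V. z e * (f (Min e) * delta v (Max e) - f (Max e) * delta v (Min e)) * g v)"
    unfolding contract_def pairing_def sum_distrib_right by (rule sum.swap)
  also have "\<dots> = pairing E z f g"
    unfolding pairing_def
  proof (rule sum.cong)
    fix e assume e: "e \<in> E"
    have *: "(\<Sum>v\<in>V. delta v i * g v) = g i" if "i \<in> V" for i
      using that fV by (simp add: delta_def if_distrib[of "\<lambda>x. x * _"] cong: if_cong)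
    have "(\<Sum>v\<in>V. z e * (f (Min e) * delta v (Max e) - f (Max e) * delta v (Min e)) * g v)
      = z e * (f (Min e) * (\<Sum>v\<in>V. delta v (Max e) * g v) - f (Max e) * (\<Sum>v\<in>V. delta v (Min e) * g v))"
      by (simp add: sum_distrib_left sum_subtractf algebra_simps)
    then show "(\<Sum>v\<in>V. z e * (f (Min e) * delta v (Max e) - f (Max e) * delta v (Min e)) * g v) =
       z e * (f (Min e) * g (Max e) - f (Max e) * g (Min e))"
      using * finite_graph_edge[OF assms e] by simp
  qed simp
  finally show ?thesis by simp
qed

lemma contract_outside:
  assumes "finite_graph V E" "v \<notin> V"
  shows "contract E z f v = 0"
  unfolding contract_def pairing_def
proof (rule sum.neutral, rule ballI)
  fix e assume "e \<in> E"
  from finite_graph_edge[OF assms(1) this] assms(2)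
  show "z e * (f (Min e) * delta v (Max e) - f (Max e) * delta v (Min e)) = 0"
    by (auto simp: delta_def)
qed

lemma contract_edge_fun:
  assumes "finite E" "e \<in> E"
  shows "contract E (edge_fun e) (\<lambda>_. 1) = delta (Max e) - delta (Min e)"
proof
  fix v
  have "contract E (edge_fun e) (\<lambda>_. 1) v =
    (\<Sum>e'\<in>E. if e' = e then delta v (Max e') - delta v (Min e') else 0)"
    unfolding contract_def pairing_def edge_fun_def by (intro sum.cong) auto
  also have "\<dots> = (delta (Max e) - delta (Min e)) v"
    using assms by (simp add: delta_def)
  finally show "contract E (edge_fun e) (\<lambda>_. 1) v = (delta (Max e) - delta (Min e) :: nat \<Rightarrow> 'a) v" .
qed

lemma contract_insert:
  assumes "finite E" "e \<notin> E"
  shows "contract (insert e E) z (\<lambda>_. 1) = contract E z (\<lambda>_. 1) + fscale (z e) (delta (Max e) - delta (Min e))"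
  using assms by (auto simp: contract_def pairing_def fun_eq_iff fscale_def delta_def)

lemma contract_cong: "(\<And>e. e \<in> E \<Longrightarrow> z e = z' e) \<Longrightarrow> contract E z f = contract E z' f"
  unfolding contract_def pairing_def by (intro ext sum.cong) auto

lemma subspace_cycle_space: "fn.subspace (cycle_space E)"
  by (rule fn.subspaceI)
    (auto simp: cycle_space_def contract_add contract_scale fscale_apply, simp add: contract_def pairing_def)

text \<open>The chain runs along a path from \<open>x\<close> to \<open>y\<close>, and the inner
  vertices cancel.\<close>

lemma conn_boundary:
  assumes "finite_graph V E" "(x, y) \<in> conn E"
  shows "\<exists>z :: nat set \<Rightarrow> 'f::field. (\<forall>e. e \<notin> E \<longrightarrow> z e = 0) \<and> contract E z (\<lambda>_. 1) = delta y - delta x"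
  using assms(2) unfolding conn_def
proof (induction rule: rtrancl_induct)
  case base
  show ?case by (intro exI[of _ 0]) (simp add: contract_def pairing_def fun_eq_iff)
next
  case (step y w)
  then have e: "{y, w} \<in> E" by simp
  obtain z :: "nat set \<Rightarrow> 'f" where z: "\<forall>e. e \<notin> E \<longrightarrow> z e = 0" "contract E z (\<lambda>_. 1) = delta y - delta x"
    using step by blast
  \<comment> \<open>Edges are oriented towards the larger endpoint, so a step downwards has
    coefficient -1.\<close>
  let ?s = "if y < w then 1 else - 1 :: 'f"
  have yw: "y \<noteq> w" using finite_graph_edge(3)[OF assms(1) e] by auto
  have "contract E (z + fscale ?s (edge_fun {y, w})) (\<lambda>_. 1) = delta w - delta x"
    using yw
    by (auto simp: contract_add contract_scale z contract_edge_fun[OF finite_graph_finite[OF assms(1)] e]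
        fun_eq_iff fscale_apply delta_def min_def max_def)
  moreover have "(z + fscale ?s (edge_fun {y, w})) e' = 0" if "e' \<notin> E" for e'
    using that z(1) e by (auto simp: fscale_apply edge_fun_def)
  ultimately show ?case by blast
qed

lemma cycle_space_insert:
  assumes "finite E" "e \<notin> E" "z e = 0"
  shows "z \<in> cycle_space (insert e E) \<longleftrightarrow> z \<in> cycle_space E"
proof -
  have "contract (insert e E) z (\<lambda>_. 1) = contract E z (\<lambda>_. 1)"
    using assms by (simp add: contract_insert)
  then show ?thesis using assms(3) unfolding cycle_space_def by auto
qed

text \<open>Induction on the edges: an edge inside a component closes one new cycle, an edge between
  two components merges them and creates none. Either way the Euler relation persists, over every
  field.\<close>

lemma cycle_space_basis:
  assumes "finite_graph V E"
  shows "\<exists>r (B :: (nat set \<Rightarrow> 'f::field) set). component_rep V E r \<and> finite B \<and> fn.independent B \<and>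
    fn.span B = cycle_space E \<and> card B + card V = card E + card (r ` V)"
proof -
  have fV: "finite V" and "finite E" using assms finite_graph_finite by (auto simp: finite_graph_def)
  show ?thesis using \<open>finite E\<close> assms
  proof (induction E rule: finite_induct)
    case empty
    have "component_rep V {} (\<lambda>x. x)" by (simp add: component_rep_def conn_refl)
    moreover have "cycle_space {} = ({0} :: (nat set \<Rightarrow> 'f) set)"
      unfolding cycle_space_def contract_def pairing_def zero_fun_def by auto
    ultimately show ?case
      by (intro exI[of _ "\<lambda>x. x"] exI[of _ "{}"]) (simp add: fn.independent_empty)
  next
    case (insert e E)
    have fgi: "finite_graph V (insert e E)" and fg: "finite_graph V E"
      using insert.prems by (auto simp: finite_graph_def)
    obtain r and B :: "(nat set \<Rightarrow> 'f) set" where r: "component_rep V E r" and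
      B: "finite B" "fn.independent B" "fn.span B = cycle_space E" "card B + card V = card E + card (r ` V)"
      using insert.IH[OF fg] by blast
    define u v where "u = Min e" and "v = Max e"
    have e: "e = {u, v}" "u < v" "u \<in> V" "v \<in> V"
      using finite_graph_edge[OF fgi, of e] unfolding u_def v_def by auto
    show ?case
    proof (cases "r u = r v")
      case True
      then have "(v, u) \<in> conn E" using component_rep_eq_iff[OF r, of v u] e by simp
      then obtain z :: "nat set \<Rightarrow> 'f" where z: "\<forall>e. e \<notin> E \<longrightarrow> z e = 0" "contract E z (\<lambda>_. 1) = delta u - delta v"
        using conn_boundary[OF fg] by blast
      \<comment> \<open>The new edge from \<open>u\<close> to \<open>v\<close>, closed up by a path
        from \<open>v\<close> back to \<open>u\<close>.\<close>
      define z0 where "z0 = z + edge_fun e"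
      have z0e: "z0 e = 1" using z insert.hyps by (simp add: z0_def edge_fun_def)
      have "contract E z0 (\<lambda>_. 1) = contract E z (\<lambda>_. 1)"
        by (rule contract_cong) (use insert.hyps in \<open>auto simp: z0_def edge_fun_def\<close>)
      then have "contract (insert e E) z0 (\<lambda>_. 1) = 0"
        using insert.hyps by (simp add: contract_insert z z0e u_def v_def)
      moreover have "z0 e' = 0" if "e' \<notin> insert e E" for e'
        using that z(1) by (simp add: z0_def edge_fun_def)
      ultimately have z0: "z0 \<in> cycle_space (insert e E)"
        by (simp add: cycle_space_def)
      have sub: "cycle_space E \<subseteq> cycle_space (insert e E)"
      proof
        fix y assume y: "y \<in> cycle_space E"
        then have "y e = 0" using insert.hyps by (simp add: cycle_space_def)
        then show "y \<in> cycle_space (insert e E)" using y cycle_space_insert insert.hyps by blast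
      qed
      have "z0 \<notin> fn.span B" using B z0e insert.hyps by (auto simp: cycle_space_def)
      then have ind: "fn.independent (insert z0 B)" "z0 \<notin> B"
        using fn.independent_insertI[OF _ B(2)] fn.span_base by blast+
      have "fn.span (insert z0 B) = cycle_space (insert e E)"
      proof
        have "insert z0 B \<subseteq> cycle_space (insert e E)" using z0 sub B fn.span_base by blast
        then show "fn.span (insert z0 B) \<subseteq> cycle_space (insert e E)"
          using subspace_cycle_space by (rule fn.span_minimal)
        show "cycle_space (insert e E) \<subseteq> fn.span (insert z0 B)"
        proof
          fix y :: "nat set \<Rightarrow> 'f" assume y: "y \<in> cycle_space (insert e E)"
          \<comment> \<open>Subtracting this multiple of \<open>z0\<close> clears the coefficient at
            \<open>e\<close> and leaves a cycle of the old graph.\<close>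
          define y' where "y' = y - fscale (y e) z0"
          have y': "y' \<in> cycle_space (insert e E)"
            unfolding y'_def using y z0 subspace_cycle_space
            by (intro fn.subspace_diff fn.subspace_scale)
          moreover have "y' e = 0" by (simp add: y'_def fscale_def z0e)
          ultimately have "y' \<in> cycle_space E"
            using insert.hyps cycle_space_insert by blast
          then show "y \<in> fn.span (insert z0 B)"
            using fn.span_breakdown_eq[of y z0 B] B unfolding y'_def by auto
        qed
      qed
      moreover have "component_rep V (insert e E) r"
        unfolding component_rep_def
      proof (intro conjI allI impI ballI)
        show "r x = r y" if "{x, y} \<in> insert e E" for x y
          using that r True e by (auto simp: component_rep_def doubleton_eq_iff)
        have "conn E \<subseteq> conn (insert e E)" by (rule conn_subset) (auto intro: conn_edge)
        then show "(x, r x) \<in> conn (insert e E)" if "x \<in> V" for x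
          using r that unfolding component_rep_def by blast
      qed (use r in \<open>simp add: component_rep_def\<close>)
      ultimately show ?thesis using B ind insert.hyps
        by (intro exI[of _ r] exI[of _ "insert z0 B"]) simp
    next
      case False
      \<comment> \<open>The component of \<open>u\<close> is absorbed into that of
        \<open>v\<close>.\<close>
      define r' where "r' = (\<lambda>i. if r i = r u then r v else r i)"
      have sub: "conn E \<subseteq> conn (insert e E)" by (rule conn_subset) (auto intro: conn_edge)
      have "component_rep V (insert e E) r'"
        unfolding component_rep_def
      proof (intro conjI allI impI ballI)
        show "r' ` V \<subseteq> V" using r e by (auto simp: r'_def component_rep_def)
        show "r' x = r' y" if "{x, y} \<in> insert e E" for x y
          using that r e by (auto simp: r'_def component_rep_def doubleton_eq_iff)
        show "(x, r' x) \<in> conn (insert e E)" if x: "x \<in> V" for x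
        proof (cases "r x = r u")
          case True
          then have "(x, u) \<in> conn E" using component_rep_eq_iff[OF r x] e by simp
          moreover have "(u, v) \<in> conn (insert e E)" using e conn_edge by blast
          moreover have "(v, r v) \<in> conn E" using r e by (simp add: component_rep_def)
          ultimately have "(x, r v) \<in> conn (insert e E)" using sub conn_trans by (meson subsetD)
          then show ?thesis using True by (simp add: r'_def)
        next
          case False
          then show ?thesis using r x sub by (auto simp: r'_def component_rep_def)
        qed
      qed
      moreover have "card (r' ` V) + 1 = card (r ` V)"
      proof -
        have "r' ` V = r ` V - {r u}"
          using False e by (auto simp: r'_def)
        then show ?thesis using e fV card_Suc_Diff1[of "r ` V" "r u"] by simp
      qed
      moreover have "cycle_space (insert e E) = (cycle_space E :: (nat set \<Rightarrow> 'f) set)"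
      proof -
        have "z e = 0" if z: "z \<in> cycle_space (insert e E)" for z :: "nat set \<Rightarrow> 'f"
        proof -
          \<comment> \<open>The indicator of the component of \<open>u\<close> before
            \<open>e\<close> is added. Only \<open>e\<close> crosses its border, so pairing a cycle
            with it isolates the coefficient at \<open>e\<close>.\<close>
          define g where "g = (\<lambda>i. if r i = r u then 1 else 0 :: 'f)"
          have "pairing (insert e E) z (\<lambda>_. 1) g = 0"
            using z unfolding pairing_eq_sum_contract[OF fgi] by (simp add: cycle_space_def)
          moreover have "g (Min e') = g (Max e')" if "e' \<in> E" for e'
          proof -
            have "{Min e', Max e'} \<in> E" using finite_graph_edge(4)[OF fg that] that by simp
            then show ?thesis using r by (simp add: g_def component_rep_def)
          qed
          then have "pairing E z (\<lambda>_. 1) g = 0" by (simp add: pairing_def)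
          moreover have "pairing (insert e E) z (\<lambda>_. 1) g = z e * (g v - g u) + pairing E z (\<lambda>_. 1) g"
            using insert.hyps by (simp add: pairing_def u_def v_def)
          ultimately show ?thesis using False by (simp add: g_def)
        qed
        moreover have "z e = 0" if "z \<in> cycle_space E" for z :: "nat set \<Rightarrow> 'f"
          using that insert.hyps by (simp add: cycle_space_def)
        ultimately show ?thesis using cycle_space_insert insert.hyps by blast
      qed
      ultimately show ?thesis using B insert.hyps
        by (intro exI[of _ r'] exI[of _ B]) simp
    qed
  qed
qed

lemma cycles1_eq: 
  assumes "finite_graph V E"
  shows "cycles1 V E = cycle_space E"
proof -
  have "boundary1 E z v = contract E z (\<lambda>_. 1) v" for z v
  proof -
    have "boundary1 E z v = (\<Sum>e\<in>E. if v \<in> e then if v = Max e then z e else - z e else 0)"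
      unfolding boundary1_def using finite_graph_finite[OF assms] by (simp add: sum.If_cases Int_def)
    also have "\<dots> = contract E z (\<lambda>_. 1) v"
      unfolding contract_def pairing_def
    proof (rule sum.cong)
      fix e assume "e \<in> E"
      from finite_graph_edge(3,4)[OF assms this] have "Max e \<noteq> Min e" "v \<in> e \<longleftrightarrow> v = Min e \<or> v = Max e"
        by (metis less_irrefl, metis insert_iff empty_iff)
      then show "(if v \<in> e then if v = Max e then z e else - z e else 0) =
          z e * (1 * delta v (Max e) - 1 * delta v (Min e))"
        by (auto simp: delta_def)
    qed simp
    finally show ?thesis .
  qed
  then show ?thesis using contract_outside[OF assms] unfolding cycles1_def cycle_space_def by metis
qed

text \<open>The Euler relation over the rationals. Its other terms are counts, which lets the
  rational Betti number be used over any field.\<close>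

lemma betti1_eq:
  assumes "finite_graph V E" "component_rep V E r"
  shows "betti1 V E + card V = card E + card (r ` V)"
proof -
  obtain r' and B :: "(nat set \<Rightarrow> rat) set" where "component_rep V E r'"
    "fn.independent B" "fn.span B = cycle_space E" "card B + card V = card E + card (r' ` V)"
    using cycle_space_basis[OF assms(1)] by blast
  then show ?thesis
    using assms num_components_eq fn.dim_span_eq_card_independent[of B]
    unfolding betti1_def cycles1_eq[OF assms(1)] by metis
qed

section \<open>Refinements\<close>

abbreviation subdivision :: "graph \<Rightarrow> nat \<Rightarrow> nat \<Rightarrow> nat \<Rightarrow> graph" where
  "subdivision H u v w \<equiv> (insert w (fst H), (snd H - {{u, v}}) \<union> {{u, w}, {w, v}})"

lemma refinement_subdivision:
  assumes "refinement G H" "{u, v} \<in> snd H" "u \<noteq> v" "w \<notin> fst H"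
  shows "refinement G (subdivision H u v w)"
  using refinement.subdivide[of G "fst H" "snd H" u v w] assms by simp

lemma refinement_graph_induct [consumes 1, case_names refl subdivide]:
  assumes "refinement G H" "P G"
    "\<And>H u v w. \<lbrakk>refinement G H; P H; {u, v} \<in> snd H; u \<noteq> v; w \<notin> fst H\<rbrakk> \<Longrightarrow> P (subdivision H u v w)"
  shows "P H"
  using assms(1)
proof (induction rule: refinement.induct)
  case (subdivide V E u v w)
  then show ?case using assms(3)[of "(V, E)" u v w] by simp
qed (rule assms(2))

lemma subdivision_edges_at:
  assumes "finite_graph (fst H) (snd H)" "w \<notin> fst H"
  shows "{e \<in> snd (subdivision H u v w). w \<in> e} = {{u, w}, {w, v}}"
    and "{e \<in> snd (subdivision H u v w). w \<notin> e} = snd H - {{u, v}}"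
proof -
  have "w \<notin> e" if "e \<in> snd H" for e using assms that unfolding finite_graph_def by blast
  then show "{e \<in> snd (subdivision H u v w). w \<in> e} = {{u, w}, {w, v}}"
    "{e \<in> snd (subdivision H u v w). w \<notin> e} = snd H - {{u, v}}" unfolding snd_conv by blast+
qed

context
  fixes V :: "nat set" and E :: "nat set set"
  assumes G: "finite_graph V E"
begin

lemma refinement_finite_graph:
  assumes "refinement (V, E) H"
  shows "finite_graph (fst H) (snd H)"
  using assms
proof (induction rule: refinement_graph_induct)
  case refl
  show ?case using G by simp
next
  case (subdivide H u v w)
  then have fin: "finite (fst H)" and edges: "\<And>e. e \<in> snd H \<Longrightarrow> e \<subseteq> fst H \<and> card e = 2"
    by (auto simp: finite_graph_def)
  have uv: "u \<in> fst H" "v \<in> fst H" using edges[OF subdivide.hyps(2)] by auto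
  then have "card {u, w} = 2" "card {w, v} = 2" using subdivide.hyps by (auto simp: card_2_iff)
  then have "e \<subseteq> insert w (fst H) \<and> card e = 2" if "e \<in> (snd H - {{u, v}}) \<union> {{u, w}, {w, v}}" for e
    using that edges uv by blast
  then show ?case using fin by (simp add: finite_graph_def)
qed

lemma refinement_edge_in:
  assumes "refinement (V, E) H" "{u, v} \<in> snd H"
  shows "u \<in> fst H" "v \<in> fst H" "u \<noteq> v"
proof -
  have "\<forall>e\<in>snd H. e \<subseteq> fst H \<and> card e = 2"
    using refinement_finite_graph[OF assms(1)] by (simp add: finite_graph_def)
  then have "{u, v} \<subseteq> fst H \<and> card {u, v} = 2" using assms(2) by (rule bspec)
  then show "u \<in> fst H" "v \<in> fst H" "u \<noteq> v" by auto
qed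

lemma refinement_vertices:
  assumes "refinement (V, E) H"
  shows "V \<subseteq> fst H"
  using assms by (induction rule: refinement_graph_induct) auto

text \<open>Both edges created by a subdivision contain the inserted vertex, which lies outside
  \<open>V\<close>.\<close>

lemma refinement_old_edge:
  assumes "refinement (V, E) H" "e \<in> snd H" "e \<subseteq> V"
  shows "e \<in> E"
  using assms
proof (induction rule: refinement_graph_induct)
  case (subdivide H u v w)
  then have "w \<notin> V" using refinement_vertices by blast
  then show ?case using subdivide by auto
qed simp

lemma refinement_card_edges:
  assumes "refinement (V, E) H"
  shows "card (snd H) + card V = card E + card (fst H)"
  using assms
proof (induction rule: refinement_graph_induct)
  case (subdivide H u v w)
  have fin: "finite (fst H)" "finite (snd H)"
    using refinement_finite_graph[OF subdivide(1)] finite_graph_finite by (auto simp: finite_graph_def)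
  have "{u, w} \<notin> snd H" "{w, v} \<notin> snd H"
    using refinement_edge_in[OF subdivide.hyps(1)] subdivide.hyps(4) by blast+
  moreover have "{u, w} \<noteq> {w, v}" using subdivide by (auto simp: doubleton_eq_iff)
  ultimately have "card (insert {u, w} (insert {w, v} (snd H - {{u, v}}))) = Suc (Suc (card (snd H - {{u, v}})))"
    using fin by simp
  moreover have "Suc (card (snd H - {{u, v}})) = card (snd H)" using fin subdivide by (intro card_Suc_Diff1)
  moreover have "(snd H - {{u, v}}) \<union> {{u, w}, {w, v}} = insert {u, w} (insert {w, v} (snd H - {{u, v}}))" by auto
  ultimately show ?case using subdivide fin by simp
qed simp

text \<open>The new vertex receives the representative of an endpoint of its edge. The
  representatives stay the same vertices of \<open>V\<close>, so the number of components of a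
  refinement is that of the original graph.\<close>

lemma refinement_component_rep:
  assumes "refinement (V, E) H" "component_rep V E r"
  shows "\<exists>r'. component_rep (fst H) (snd H) r' \<and> r' ` fst H = r ` V"
  using assms(1)
proof (induction rule: refinement_graph_induct)
  case refl
  then show ?case using assms(2) by auto
next
  case (subdivide H u v w)
  obtain r' where r': "component_rep (fst H) (snd H) r'" "r' ` fst H = r ` V" using subdivide by blast
  have uv: "u \<in> fst H" "v \<in> fst H" "u \<noteq> w" "v \<noteq> w" using refinement_edge_in[OF subdivide.hyps(1,2)] subdivide.hyps by auto
  define q where "q = r'(w := r' u)"
  let ?E = "(snd H - {{u, v}}) \<union> {{u, w}, {w, v}}"
  have uv': "r' u = r' v" using r'(1) subdivide.hyps(2) unfolding component_rep_def by blast
  have im: "q ` insert w (fst H) = r' ` fst H"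
  proof -
    have "q ` fst H = r' ` fst H" using subdivide.hyps(4) by (intro image_cong) (auto simp: q_def)
    moreover have "q w = r' u" by (simp add: q_def)
    ultimately show ?thesis using uv(1) by (simp add: insert_absorb)
  qed
  have sub: "conn (snd H) \<subseteq> conn ?E"
  proof (rule conn_subset)
    fix x y assume xy: "{x, y} \<in> snd H"
    show "(x, y) \<in> conn ?E"
    proof (cases "{x, y} = {u, v}")
      case True
      have "(u, w) \<in> conn ?E" "(w, v) \<in> conn ?E" by (auto intro!: conn_edge)
      then have "(u, v) \<in> conn ?E" by (rule conn_trans)
      then show ?thesis using True conn_sym by (auto simp: doubleton_eq_iff)
    qed (use xy conn_edge in auto)
  qed
  have "component_rep (insert w (fst H)) ?E q"
    unfolding component_rep_def
  proof (intro conjI allI impI ballI)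
    show "q ` insert w (fst H) \<subseteq> insert w (fst H)" using im r' by (auto simp: component_rep_def)
    show "q x = q y" if "{x, y} \<in> ?E" for x y
    proof (cases "{x, y} \<in> snd H")
      case True
      then have "x \<noteq> w" "y \<noteq> w" using refinement_edge_in[OF subdivide.hyps(1) True] subdivide.hyps by auto
      then show ?thesis using True r' by (simp add: q_def component_rep_def)
    next
      case False
      then show ?thesis using that uv uv' by (auto simp: doubleton_eq_iff q_def)
    qed
    show "(x, q x) \<in> conn ?E" if "x \<in> insert w (fst H)" for x
    proof (cases "x = w")
      case True
      have "(w, u) \<in> conn ?E" by (rule conn_edge) (auto simp: insert_commute)
      moreover have "(u, r' u) \<in> conn ?E" using r' uv sub by (auto simp: component_rep_def)
      ultimately have "(w, r' u) \<in> conn ?E" by (rule conn_trans)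
      then show ?thesis using True by (simp add: q_def)
    next
      case False
      then have "(x, r' x) \<in> conn (snd H)" using r' that by (simp add: component_rep_def)
      then show ?thesis using False sub by (auto simp: q_def)
    qed
  qed
  then show ?case using im r' by auto
qed

text \<open>Both sides replace the edge \<open>pq\<close> by the path through p, x, w, q: either
  \<open>w\<close> is inserted and then \<open>x\<close> on the edge \<open>pw\<close>, or
  \<open>x\<close> and then \<open>w\<close> on the edge \<open>xq\<close>. Edges are opaque
  variables here, so that the identity is plain set algebra.\<close>

lemma path_swap:
  "\<lbrakk>pw \<notin> A; xq \<notin> A; pw \<noteq> wq; xq \<noteq> px\<rbrakk> \<Longrightarrow>
   (((A - {pq}) \<union> {pw, wq}) - {pw}) \<union> {px, xw} = (((A - {pq}) \<union> {px, xq}) - {xq}) \<union> {xw, wq}"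
  by auto

lemma replace_commute:
  "\<lbrakk>ab \<noteq> uw; ab \<noteq> wv; uv \<noteq> ax; uv \<noteq> xb\<rbrakk> \<Longrightarrow>
   (((A - {uv}) \<union> {uw, wv}) - {ab}) \<union> {ax, xb} = (((A - {ab}) \<union> {ax, xb}) - {uv}) \<union> {uw, wv}"
  by auto

text \<open>Any new vertex can be regarded as the last one inserted, because a later subdivision
  either commutes with that of \<open>w\<close> or can be exchanged with it along the same edge.
  This is what allows peeling off the largest label.\<close>

lemma refinement_last_vertex:
  assumes "refinement (V, E) H" "w \<in> fst H" "w \<notin> V"
  shows "\<exists>H' u v. refinement (V, E) H' \<and> {u, v} \<in> snd H' \<and> u \<noteq> v \<and> w \<notin> fst H' \<and> H = subdivision H' u v w"
  using assms
proof (induction rule: refinement_graph_induct)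
  case (subdivide H a b x)
  have ab: "a \<in> fst H" "b \<in> fst H" using refinement_edge_in[OF subdivide.hyps(1,2)] by auto
  show ?case
  proof (cases "x = w")
    case True
    then show ?thesis using subdivide by blast
  next
    case False
    then obtain H' u v where H': "refinement (V, E) H'" "{u, v} \<in> snd H'" "u \<noteq> v" "w \<notin> fst H'"
      and H: "H = subdivision H' u v w"
      using subdivide by auto
    have uv: "u \<in> fst H'" "v \<in> fst H'" using refinement_edge_in[OF H'(1,2)] by auto
    have x: "x \<notin> fst H'" "x \<noteq> w" using subdivide H by auto
    have edge_w: "\<And>c d. {c, d} \<in> snd H' \<Longrightarrow> c \<noteq> w \<and> d \<noteq> w \<and> c \<noteq> x \<and> d \<noteq> x"
      using refinement_edge_in[OF H'(1)] H'(4) x by blast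
    \<comment> \<open>If \<open>x\<close> subdivides an edge at \<open>w\<close>, exchange the two subdivisions.\<close>
    have swap: "\<exists>H'' u' v'. refinement (V, E) H'' \<and> {u', v'} \<in> snd H'' \<and> u' \<noteq> v' \<and> w \<notin> fst H'' \<and>
        subdivision H a b x = subdivision H'' u' v' w"
      if p: "{p, q} \<in> snd H'" "p \<noteq> q" "H = subdivision H' p q w" "{a, b} = {p, w}" for p q
    proof -
      let ?H = "subdivision H' p q x"
      have pq: "p \<in> fst H'" "q \<in> fst H'" using refinement_edge_in[OF H'(1) p(1)] by auto
      have "refinement (V, E) ?H" using refinement_subdivision[OF H'(1) p(1,2) x(1)] .
      moreover have "{x, q} \<in> snd ?H" "x \<noteq> q" "w \<notin> fst ?H" using x pq H' by auto
      moreover have "subdivision H a b x = subdivision ?H x q w"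
      proof (rule prod_eqI)
        show "fst (subdivision H a b x) = fst (subdivision ?H x q w)" using p(3) by auto
        have n: "{p, w} \<notin> snd H'" "{x, q} \<notin> snd H'" using edge_w by blast+
        have d: "{p, w} \<noteq> {w, q}" "{x, q} \<noteq> {p, x}" using p(2) by (auto simp: doubleton_eq_iff)
        have "{{a, x}, {x, b}} = {{p, x}, {x, w}}"
          using p(4) by (auto simp: doubleton_eq_iff insert_commute)
        then have "snd (subdivision H a b x) = (((snd H' - {{p, q}}) \<union> {{p, w}, {w, q}}) - {{p, w}}) \<union> {{p, x}, {x, w}}"
          using p(3,4) by simp
        also have "\<dots> = (((snd H' - {{p, q}}) \<union> {{p, x}, {x, q}}) - {{x, q}}) \<union> {{x, w}, {w, q}}"
          by (rule path_swap[OF n d])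
        finally show "snd (subdivision H a b x) = snd (subdivision ?H x q w)" by simp
      qed
      ultimately show ?thesis by blast
    qed
    consider "{a, b} = {u, w}" | "{a, b} = {w, v}" | "{a, b} \<in> snd H'" "{a, b} \<noteq> {u, v}"
      using subdivide.hyps(2) H by auto
    then show ?thesis
    proof cases
      case 1
      then show ?thesis using swap[of u v] H H' by blast
    next
      case 2
      \<comment> \<open>Reading the edge backwards turns the second half into the first.\<close>
      have "H = subdivision H' v u w" using H by (auto simp: insert_commute)
      then show ?thesis using swap[of v u] 2 H' by (simp add: insert_commute)
    next
      case 3
      let ?H = "subdivision H' a b x"
      have "refinement (V, E) ?H" using refinement_subdivision[OF H'(1) 3(1) _ x(1)] subdivide.hyps(3) by simp
      moreover have "{u, v} \<in> snd ?H" "w \<notin> fst ?H" using 3 H' x by auto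
      moreover have "subdivision H a b x = subdivision ?H u v w"
      proof (rule prod_eqI)
        have "w \<notin> {a, b}" "x \<notin> {u, v}" using edge_w[OF 3(1)] x uv by auto
        then have "{a, b} \<noteq> {u, w}" "{a, b} \<noteq> {w, v}" "{u, v} \<noteq> {a, x}" "{u, v} \<noteq> {x, b}" by blast+
        then have "(((snd H' - {{u, v}}) \<union> {{u, w}, {w, v}}) - {{a, b}}) \<union> {{a, x}, {x, b}} =
            (((snd H' - {{a, b}}) \<union> {{a, x}, {x, b}}) - {{u, v}}) \<union> {{u, w}, {w, v}}"
          by (rule replace_commute)
        then show "snd (subdivision H a b x) = snd (subdivision ?H u v w)"
          using H by simp
      qed (use H in auto)
      ultimately show ?thesis using H'(3) by blast
    qed
  qed
qed simp

text \<open>If \<open>w\<close> is inserted last, its edges are exactly the two halves of the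
  subdivided edge.\<close>

lemma refinement_new_vertex_edges:
  assumes "refinement (V, E) H" "w \<in> fst H" "w \<notin> V"
  shows "\<exists>u v. u \<noteq> v \<and> u \<noteq> w \<and> v \<noteq> w \<and> u \<in> fst H \<and> v \<in> fst H \<and> {e\<in>snd H. w \<in> e} = {{u, w}, {w, v}}"
proof -
  obtain H' u v where H': "refinement (V, E) H'" "{u, v} \<in> snd H'" "u \<noteq> v" "w \<notin> fst H'"
      and H: "H = subdivision H' u v w"
    using refinement_last_vertex[OF assms] by blast
  have uv: "u \<in> fst H'" "v \<in> fst H'" using refinement_edge_in[OF H'(1,2)] by auto
  have "{e\<in>snd H. w \<in> e} = {{u, w}, {w, v}}"
    unfolding H by (rule subdivision_edges_at(1)[OF refinement_finite_graph[OF H'(1)] H'(4)])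
  moreover have "u \<noteq> w" "v \<noteq> w" using uv H'(4) by auto
  moreover have "u \<in> fst H" "v \<in> fst H" using uv H by simp_all
  ultimately show ?thesis using H'(3) by blast
qed

section \<open>Counting refinements\<close>

lemma finite_refinements_on: "finite (refinements_on (V, E) n)"
proof (rule finite_subset)
  show "refinements_on (V, E) n \<subseteq> {{1..n}} \<times> Pow (Pow {1..n})"
  proof
    fix H assume "H \<in> refinements_on (V, E) n"
    then have "fst H = {1..n}" "\<forall>e\<in>snd H. e \<subseteq> fst H"
      using refinement_finite_graph[of H] unfolding refinements_on_def finite_graph_def by blast+
    then show "H \<in> {{1..n}} \<times> Pow (Pow {1..n})" by (cases H) auto
  qed
qed simp

lemma ex_refinement:
  assumes "finite W" "V \<subseteq> W" "E \<noteq> {}"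
  shows "\<exists>H. refinement (V, E) H \<and> fst H = W"
proof -
  have "\<exists>H. refinement (V, E) H \<and> fst H = V \<union> D" if "finite D" "D \<inter> V = {}" for D
    using that
  proof (induction D rule: finite_induct)
    case empty
    show ?case by (intro exI[of _ "(V, E)"]) (simp add: refinement.refl)
  next
    case (insert w D)
    then obtain H where H: "refinement (V, E) H" "fst H = V \<union> D" by auto
    \<comment> \<open>The edge count exceeds that of \<open>E\<close> by the number of inserted
      vertices, so there is always an edge left to subdivide.\<close>
    have "card (snd H) \<noteq> 0"
    proof -
      have "finite (fst H)" "V \<subseteq> fst H" using H insert G by (auto simp: finite_graph_def)
      then have "card V \<le> card (fst H)" by (rule card_mono)
      moreover have "card E > 0" using assms(3) finite_graph_finite[OF G] by (simp add: card_gt_0_iff)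
      ultimately show ?thesis using refinement_card_edges[OF H(1)] by linarith
    qed
    then obtain e where "e \<in> snd H" by fastforce
    then have "{Min e, Max e} \<in> snd H" "Min e \<noteq> Max e"
      using finite_graph_edge[OF refinement_finite_graph[OF H(1)]] by (metis, metis less_irrefl)
    then have "refinement (V, E) (subdivision H (Min e) (Max e) w)"
      using H insert by (intro refinement_subdivision) auto
    then show ?case using H by (intro exI[of _ "subdivision H (Min e) (Max e) w"]) auto
  qed
  moreover have "(W - V) \<inter> V = {}" "V \<union> (W - V) = W" using assms(2) by auto
  ultimately show ?thesis using assms(1) by (metis finite_Diff)
qed

definition refine_at :: "nat \<Rightarrow> graph \<times> nat set \<Rightarrow> graph" where
  "refine_at w = (\<lambda>(H, e). subdivision H (Min e) (Max e) w)"

lemma subdivision_eq_refine_at: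
  assumes "refinement (V, E) H" "{u, v} \<in> snd H"
  shows "subdivision H u v w = refine_at w (H, {u, v})"
  using refinement_edge_in(3)[OF assms]
  by (cases "u < v") (auto simp: refine_at_def insert_commute min_def max_def)

text \<open>Surjectivity takes the largest label as the last vertex inserted. For injectivity, the
  two neighbours of the vertex \<open>Suc n\<close> recover the subdivided edge, and the edges
  avoiding it recover the rest.\<close>

lemma bij_betw_refine_at:
  assumes "Suc n \<notin> V"
  shows "bij_betw (refine_at (Suc n)) (Sigma (refinements_on (V, E) n) snd) (refinements_on (V, E) (Suc n))"
  unfolding bij_betw_def
proof
  let ?w = "Suc n"
  have graph: "finite_graph (fst H) (snd H)" "?w \<notin> fst H" if "H \<in> refinements_on (V, E) n" for H
    using that refinement_finite_graph[of H] by (simp_all add: refinements_on_def)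
  have edge: "{Min e, Max e} = e" "Min e \<noteq> Max e" "Min e \<noteq> ?w" "Max e \<noteq> ?w"
    if "H \<in> refinements_on (V, E) n" "e \<in> snd H" for H e
    using finite_graph_edge[OF graph(1)[OF that(1)] that(2)] graph(2)[OF that(1)] by auto
  have rec_edge: "e = \<Union> {f \<in> snd (refine_at ?w (H, e)). ?w \<in> f} - {?w}"
    if H: "H \<in> refinements_on (V, E) n" "e \<in> snd H" for H e
  proof -
    have "{f \<in> snd (refine_at ?w (H, e)). ?w \<in> f} = {{Min e, ?w}, {?w, Max e}}"
      unfolding refine_at_def prod.case by (rule subdivision_edges_at(1)[OF graph[OF H(1)]])
    then have "\<Union> {f \<in> snd (refine_at ?w (H, e)). ?w \<in> f} - {?w} = {Min e, Max e}"
      using edge(3,4)[OF H] by auto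
    then show ?thesis using edge(1)[OF H] by simp
  qed
  have rec_edges: "snd H = insert e {f \<in> snd (refine_at ?w (H, e)). ?w \<notin> f}"
    if H: "H \<in> refinements_on (V, E) n" "e \<in> snd H" for H e
  proof -
    have "{f \<in> snd (refine_at ?w (H, e)). ?w \<notin> f} = snd H - {{Min e, Max e}}"
      unfolding refine_at_def prod.case by (rule subdivision_edges_at(2)[OF graph[OF H(1)]])
    then show ?thesis using H(2) edge(1)[OF H] by auto
  qed
  show "inj_on (refine_at ?w) (Sigma (refinements_on (V, E) n) snd)"
  proof (rule inj_onI)
    fix p1 p2 assume p: "p1 \<in> Sigma (refinements_on (V, E) n) snd" "p2 \<in> Sigma (refinements_on (V, E) n) snd"
      and eq: "refine_at ?w p1 = refine_at ?w p2"
    obtain H1 e1 H2 e2 where p12: "p1 = (H1, e1)" "p2 = (H2, e2)" by (cases p1, cases p2) blast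
    have 1: "H1 \<in> refinements_on (V, E) n" "e1 \<in> snd H1" and 2: "H2 \<in> refinements_on (V, E) n" "e2 \<in> snd H2"
      using p p12 by auto
    have "e1 = e2" using rec_edge[OF 1] rec_edge[OF 2] eq p12 by simp
    moreover from this have "snd H1 = snd H2" using rec_edges[OF 1] rec_edges[OF 2] eq p12 by simp
    moreover have "fst H1 = fst H2" using 1 2 by (simp add: refinements_on_def)
    ultimately show "p1 = p2" using p12 by (simp add: prod_eq_iff)
  qed
  show "refine_at ?w ` Sigma (refinements_on (V, E) n) snd = refinements_on (V, E) ?w"
  proof (intro equalityI subsetI)
    fix H' assume "H' \<in> refine_at ?w ` Sigma (refinements_on (V, E) n) snd"
    then obtain p where p: "p \<in> Sigma (refinements_on (V, E) n) snd" "H' = refine_at ?w p" by blast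
    obtain H e where "p = (H, e)" by (cases p)
    then have H: "H \<in> refinements_on (V, E) n" "e \<in> snd H" "H' = subdivision H (Min e) (Max e) ?w"
      using p by (auto simp: refine_at_def)
    have "refinement (V, E) H'" unfolding H(3)
    proof (rule refinement_subdivision)
      show "refinement (V, E) H" using H(1) by (simp add: refinements_on_def)
      show "{Min e, Max e} \<in> snd H" unfolding edge(1)[OF H(1,2)] by (rule H(2))
    qed (rule edge(2)[OF H(1,2)], rule graph(2)[OF H(1)])
    moreover have "fst H' = {1..?w}"
      unfolding H(3) using H(1) by (simp add: refinements_on_def atLeastAtMostSuc_conv)
    ultimately show "H' \<in> refinements_on (V, E) ?w" by (simp add: refinements_on_def)
  next
    fix H' assume "H' \<in> refinements_on (V, E) ?w"
    then have H': "refinement (V, E) H'" "fst H' = {1..?w}" by (auto simp: refinements_on_def)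
    have "?w \<in> fst H'" unfolding H'(2) by simp
    then obtain H u v where H: "refinement (V, E) H" "{u, v} \<in> snd H" "?w \<notin> fst H" "H' = subdivision H u v ?w"
      using refinement_last_vertex[OF H'(1) _ assms] by blast
    have "insert ?w (fst H) = {1..?w}" using H'(2) unfolding H(4) by simp
    then have "insert ?w (fst H) = insert ?w {1..n}" by (simp add: atLeastAtMostSuc_conv)
    then have "fst H = {1..n}" using H(3) insert_ident[of ?w "fst H" "{1..n}"] by simp
    then have "H \<in> refinements_on (V, E) n" using H(1) by (simp add: refinements_on_def)
    then show "H' \<in> refine_at ?w ` Sigma (refinements_on (V, E) n) snd"
      unfolding H(4) subdivision_eq_refine_at[OF H(1,2)] using H(2) by (intro imageI SigmaI)
  qed
qed

text \<open>All refinements on \<open>n\<close> vertices have the same number of edges, hence the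
  same number of extensions. So a uniform refinement arises by subdividing a uniform edge of a
  uniform refinement.\<close>

lemma card_refinements_on_Suc:
  assumes "Suc n \<notin> V"
  shows "card (refinements_on (V, E) (Suc n)) = card (refinements_on (V, E) n) * (card E + n - card V)"
proof -
  have "card (snd H) = card E + n - card V" if "H \<in> refinements_on (V, E) n" for H
    using refinement_card_edges[of H] that by (simp add: refinements_on_def)
  moreover have "finite (snd H)" if "H \<in> refinements_on (V, E) n" for H
    using that finite_graph_finite[OF refinement_finite_graph[of H]] by (simp add: refinements_on_def)
  ultimately have "card (Sigma (refinements_on (V, E) n) snd) =
      card (refinements_on (V, E) n) * (card E + n - card V)"
    using finite_refinements_on by (simp add: card_SigmaI)
  then show ?thesis using bij_betw_same_card[OF bij_betw_refine_at[OF assms]] by simp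
qed

text \<open>The bijection is restricted to the pairs whose subdivided edge differs from
  \<open>e\<close>. As \<open>e\<close> does not contain \<open>Suc n\<close>, it cannot reappear as
  one of the two new halves.\<close>

lemma card_refinements_on_edge_Suc:
  assumes "Suc n \<notin> V" "e \<in> E"
  shows "card {H \<in> refinements_on (V, E) (Suc n). e \<in> snd H} =
    card {H \<in> refinements_on (V, E) n. e \<in> snd H} * (card E + n - card V - 1)"
proof -
  let ?A = "{H \<in> refinements_on (V, E) n. e \<in> snd H}"
  have e: "Suc n \<notin> e" using assms G by (auto simp: finite_graph_def)
  have iff: "e \<in> snd (refine_at (Suc n) (H, f)) \<longleftrightarrow> e \<in> snd H \<and> e \<noteq> f"
    if H: "H \<in> refinements_on (V, E) n" "f \<in> snd H" for H f
  proof -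
    have "finite_graph (fst H) (snd H)" using H refinement_finite_graph[of H] by (simp add: refinements_on_def)
    from finite_graph_edge(4)[OF this H(2)] e show ?thesis
      unfolding refine_at_def by auto
  qed
  have im: "refine_at (Suc n) ` Sigma ?A (\<lambda>H. snd H - {e}) = {H \<in> refinements_on (V, E) (Suc n). e \<in> snd H}"
  proof (intro equalityI subsetI)
    fix H' assume "H' \<in> refine_at (Suc n) ` Sigma ?A (\<lambda>H. snd H - {e})"
    then obtain H f where H: "H \<in> refinements_on (V, E) n" "f \<in> snd H" "e \<in> snd H" "e \<noteq> f" "H' = refine_at (Suc n) (H, f)"
      by blast
    then have "H' \<in> refinements_on (V, E) (Suc n)"
      using bij_betw_refine_at[OF assms(1)] unfolding bij_betw_def by blast
    then show "H' \<in> {H \<in> refinements_on (V, E) (Suc n). e \<in> snd H}" using H iff by simp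
  next
    fix H' assume H': "H' \<in> {H \<in> refinements_on (V, E) (Suc n). e \<in> snd H}"
    then have "H' \<in> refine_at (Suc n) ` Sigma (refinements_on (V, E) n) snd"
      using bij_betw_refine_at[OF assms(1)] unfolding bij_betw_def by blast
    then obtain H f where "H \<in> refinements_on (V, E) n" "f \<in> snd H" "H' = refine_at (Suc n) (H, f)"
      by blast
    then show "H' \<in> refine_at (Suc n) ` Sigma ?A (\<lambda>H. snd H - {e})" using H' iff by blast
  qed
  have inj: "inj_on (refine_at (Suc n)) (Sigma ?A (\<lambda>H. snd H - {e}))"
    by (rule inj_on_subset[OF bij_betw_imp_inj_on[OF bij_betw_refine_at[OF assms(1)]]]) blast
  have "card {H \<in> refinements_on (V, E) (Suc n). e \<in> snd H} = card (Sigma ?A (\<lambda>H. snd H - {e}))"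
    using card_image[OF inj] unfolding im .
  moreover have "card (snd H - {e}) = card E + n - card V - 1" if "H \<in> ?A" for H
    using refinement_card_edges[of H] that by (simp add: refinements_on_def)
  moreover have "finite (snd H - {e})" if "H \<in> ?A" for H
    using that finite_graph_finite[OF refinement_finite_graph[of H]] by (simp add: refinements_on_def)
  ultimately show ?thesis using finite_refinements_on by (simp add: card_SigmaI)
qed

text \<open>
  The next vertex goes into a uniformly random edge, which multiplies the probability that \<open>e\<close>
  survives by \<open>(m - 1) / m\<close>, \<open>m\<close> being the number of edges. So this probability times \<open>m - 1\<close>
  does not depend on \<open>n\<close>.
\<close>
lemma card_refinements_on_edge:
  assumes "V \<subseteq> {1..n0}" "n0 \<le> n" "e \<in> E"
  shows "card {H \<in> refinements_on (V, E) n. e \<in> snd H} * (card E + n - card V - 1) * card (refinements_on (V, E) n0) =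
    card {H \<in> refinements_on (V, E) n0. e \<in> snd H} * (card E + n0 - card V - 1) * card (refinements_on (V, E) n)"
  using assms(2)
proof (induction n rule: dec_induct)
  case (step n)
  have nV: "Suc n \<notin> V" using assms(1) step by auto
  let ?m = "card E + n - card V"
  \<comment> \<open>The factor \<open>m - 1\<close> of the next stage is the factor \<open>m\<close>
    of this one, so the products telescope. Truncated subtraction is safe because
    \<open>card V \<le> n0 \<le> n\<close>.\<close>
  have "card E + Suc n - card V - 1 = ?m"
    using card_mono[OF _ assms(1)] step(1) by simp
  then have "card {H \<in> refinements_on (V, E) (Suc n). e \<in> snd H} * (card E + Suc n - card V - 1) * card (refinements_on (V, E) n0)
     = (card {H \<in> refinements_on (V, E) n. e \<in> snd H} * (?m - 1) * card (refinements_on (V, E) n0)) * ?m"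
    unfolding card_refinements_on_edge_Suc[OF nV assms(3)] by (simp only: mult_ac)
  also have "\<dots> = (card {H \<in> refinements_on (V, E) n0. e \<in> snd H} * (card E + n0 - card V - 1) * card (refinements_on (V, E) n)) * ?m"
    unfolding step.IH ..
  finally show ?case unfolding card_refinements_on_Suc[OF nV] by (simp only: mult_ac)
qed simp

lemma tendsto_prob_edge_survives:
  assumes "V \<subseteq> {1..}" "e \<in> E"
  shows "(\<lambda>n. measure_pmf.prob (pmf_of_set (refinements_on (V, E) n)) {H. e \<in> snd H}) \<longlonglongrightarrow> 0"
proof -
  let ?R = "\<lambda>n. refinements_on (V, E) n" and ?A = "\<lambda>n. {H \<in> refinements_on (V, E) n. e \<in> snd H}"
  have fV: "finite V" using G by (simp add: finite_graph_def)
  define n0 where "n0 = Max (insert 0 V)"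
  have V: "V \<subseteq> {1..n0}" using assms(1) fV by (auto simp: n0_def)
  have ne: "?R n \<noteq> {}" if "n \<ge> n0" for n
    using ex_refinement[of "{1..n}"] V that assms(2) by (fastforce simp: refinements_on_def)
  \<comment> \<open>The invariant, survival probability times number of edges minus 1, evaluated at
    \<open>n0\<close>.\<close>
  define C where "C = real (card (?A n0) * (card E + n0 - card V - 1)) / real (card (?R n0))"
  have "measure_pmf.prob (pmf_of_set (?R n)) {H. e \<in> snd H} = C / real (card E + n - card V - 1)"
    \<comment> \<open>The offset 2 makes \<open>card E + n - card V - 1\<close> positive.\<close>
    if n: "n \<ge> n0 + 2" for n
  proof -
    have "card V \<le> n0" using card_mono[OF _ V] by simp
    then have m: "card E + n - card V - 1 > 0" using n by linarith
    have pos: "card (?R n) > 0" "card (?R n0) > 0"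
      using ne n finite_refinements_on by (simp_all add: card_gt_0_iff)
    have "measure_pmf.prob (pmf_of_set (?R n)) {H. e \<in> snd H} = real (card (?A n)) / real (card (?R n))"
      using ne n finite_refinements_on by (simp add: measure_pmf_of_set Int_def)
    moreover have "real (card (?A n)) * real (card E + n - card V - 1) * real (card (?R n0)) =
        real (card (?A n0) * (card E + n0 - card V - 1)) * real (card (?R n))"
      using arg_cong[OF card_refinements_on_edge[OF V _ assms(2), of n], of real] n by simp
    moreover have "a / R = c / R0 / M" if "a * M * R0 = c * R" "R > 0" "M > 0" "R0 > 0" for a R c R0 M :: real
      using that by (simp add: field_simps)
    ultimately show ?thesis
      using m pos unfolding C_def by simp
  qed
  then have "\<forall>\<^sub>F n in sequentially. C / real (card E + n - card V - 1) =
      measure_pmf.prob (pmf_of_set (?R n)) {H. e \<in> snd H}"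
    unfolding eventually_sequentially by metis
  moreover have "(\<lambda>n. C / real (card E + n - card V - 1)) \<longlonglongrightarrow> 0"
  proof -
    have "(\<lambda>n. C / real n) \<longlonglongrightarrow> 0" by (rule lim_const_over_n)
    moreover have "filterlim (\<lambda>n. card E + n - card V - 1) sequentially sequentially"
      unfolding filterlim_at_top
    proof
      fix Z show "\<forall>\<^sub>F n in sequentially. Z \<le> card E + n - card V - 1"
        using eventually_ge_at_top[of "Z + card V + 1"] by eventually_elim linarith
    qed
    ultimately show ?thesis by (rule filterlim_compose)
  qed
  ultimately show ?thesis by (rule Lim_transform_eventually[rotated])
qed

end

section \<open>A specialisation of the generic basis\<close>

definition dot :: "nat set \<Rightarrow> (nat \<Rightarrow> 'f::field) \<Rightarrow> (nat \<Rightarrow> 'f) \<Rightarrow> 'f" where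
  "dot W u f = (\<Sum>i\<in>W. u i * f i)"

text \<open>A dimension bound for a set that need not be known to be a subspace. Finiteness is
  included because \<open>card\<close> is zero on infinite sets.\<close>

definition rank_le :: "('i \<Rightarrow> 'f::field) set \<Rightarrow> nat \<Rightarrow> bool" where
  "rank_le U d \<longleftrightarrow> (\<forall>B\<subseteq>U. fn.independent B \<longrightarrow> finite B \<and> card B \<le> d)"


lemma rank_leD: "rank_le U d \<Longrightarrow> B \<subseteq> U \<Longrightarrow> fn.independent B \<Longrightarrow> finite B \<and> card B \<le> d"
  by (simp add: rank_le_def)

lemma rank_le_span:
  assumes "finite T" "U \<subseteq> fn.span T" "card T \<le> d"
  shows "rank_le U d"
  unfolding rank_le_def
proof (intro allI impI)
  fix B assume "B \<subseteq> U" "fn.independent B"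
  then have "finite B \<and> card B \<le> card T"
    using fn.independent_span_bound[OF assms(1)] assms(2) by blast
  then show "finite B \<and> card B \<le> d" using assms(3) by linarith
qed

lemma rank_le_0D:
  assumes "rank_le U 0" "u \<in> U"
  shows "u = 0"
proof (rule ccontr)
  assume "u \<noteq> 0"
  then have "fn.independent {u}" by simp
  then have "finite {u} \<and> card {u} \<le> 0" using assms by (intro rank_leD[of U 0]) auto
  then show False by simp
qed

lemma rank_le_zero:
  assumes "U \<subseteq> {0}"
  shows "rank_le U d"
  by (rule rank_le_span[of "{}"]) (use assms in simp_all)

text \<open>The vector \<open>u0\<close> lies outside the kernel of \<open>\<phi>\<close>, so it
  extends every independent subset of that kernel.\<close>

lemma rank_le_cut:
  assumes "rank_le U d" "u0 \<in> U" "\<phi> u0 \<noteq> 0"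
    and "\<And>x y. \<phi> (x + y) = \<phi> x + \<phi> y" "\<And>a x. \<phi> (fscale a x) = a * \<phi> x"
  shows "rank_le {u \<in> U. \<phi> u = 0} (d - 1)"
  unfolding rank_le_def
proof (intro allI impI)
  fix B assume B: "B \<subseteq> {u \<in> U. \<phi> u = 0}" "fn.independent B"
  have "fn.subspace {x. \<phi> x = 0}"
  proof (rule fn.subspaceI)
    have "\<phi> 0 = 0" using assms(5)[of 0 0] by (simp add: fscale_def zero_fun_def)
    then show "0 \<in> {x. \<phi> x = 0}" by simp
  qed (use assms in simp_all)
  then have "fn.span B \<subseteq> {x. \<phi> x = 0}" using B(1) by (intro fn.span_minimal) auto
  then have u0: "u0 \<notin> fn.span B" using assms(3) by blast
  then have "fn.independent (insert u0 B)" by (rule fn.independent_insertI[OF _ B(2)])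
  moreover have "insert u0 B \<subseteq> U" using B(1) assms(2) by blast
  ultimately have "finite (insert u0 B) \<and> card (insert u0 B) \<le> d"
    by (intro rank_leD[OF assms(1)])
  moreover have "u0 \<notin> B" using u0 fn.span_base by blast
  ultimately show "finite B \<and> card B \<le> d - 1" by (auto simp: card_insert_if)
qed

section \<open>Vectors separating two spaces\<close>

lemma dot_delta: "finite W \<Longrightarrow> i \<in> W \<Longrightarrow> dot W u (delta i) = u i"
  by (simp add: dot_def delta_def if_distrib[of "\<lambda>x. _ * x"] cong: if_cong)

lemma dot_add: "dot W (u + v) f = dot W u f + dot W v f"
  by (simp add: dot_def distrib_right sum.distrib)

lemma dot_scale: "dot W (fscale a u) f = a * dot W u f"
  by (simp add: dot_def fscale_apply sum_distrib_left mult.assoc)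

lemma dot_add_right: "dot W u (f + g) = dot W u f + dot W u g"
  by (simp add: dot_def distrib_left sum.distrib)

text \<open>Two hyperplanes do not cover the space. A unit vector or a sum of two unit vectors is a
  witness, so this holds even over the field with two elements.\<close>

lemma ex_not_orthogonal:
  assumes "finite W" "u \<noteq> 0" "u' \<noteq> 0" "\<And>i. i \<notin> W \<Longrightarrow> u i = 0" "\<And>i. i \<notin> W \<Longrightarrow> u' i = 0"
  shows "\<exists>f. dot W u f \<noteq> 0 \<and> dot W u' f \<noteq> 0"
proof -
  obtain i where i: "u i \<noteq> 0" using assms(2) by (auto simp: fun_eq_iff)
  obtain j where j: "u' j \<noteq> 0" using assms(3) by (auto simp: fun_eq_iff)
  have W: "i \<in> W" "j \<in> W" using i j assms(4,5) by blast+
  show ?thesis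
  proof (cases "u' i = 0")
    case False
    then show ?thesis using i W dot_delta[OF assms(1)] by metis
  next
    case i': True
    show ?thesis
    proof (cases "u j = 0")
      case False
      then show ?thesis using j W dot_delta[OF assms(1)] by metis
    next
      case True
      have "dot W u (delta i + delta j) \<noteq> 0 \<and> dot W u' (delta i + delta j) \<noteq> 0"
        using i j i' True W assms(1) by (simp add: dot_add_right dot_delta)
      then show ?thesis by blast
    qed
  qed
qed

text \<open>Each new vector is chosen to cut \<open>P\<close> and \<open>Q\<close> at once. Since
  \<open>q \<le> p\<close>, the set \<open>Q\<close> is exhausted first, and an initial segment of
  the same sequence separates it.\<close>

lemma ex_separating:
  fixes P Q :: "(nat \<Rightarrow> 'f::field) set"
  assumes "finite W" "\<forall>u\<in>P \<union> Q. \<forall>i. i \<notin> W \<longrightarrow> u i = 0"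
    and "rank_le P p" "rank_le Q q" "q \<le> p"
  shows "\<exists>F :: nat \<Rightarrow> nat \<Rightarrow> 'f. (\<forall>u\<in>P. (\<forall>j<p. dot W u (F j) = 0) \<longrightarrow> u = 0) \<and>
    (\<forall>u\<in>Q. (\<forall>j<q. dot W u (F j) = 0) \<longrightarrow> u = 0)"
  using assms(2-5)
proof (induction p arbitrary: P Q q)
  case 0
  then have "q = 0" by simp
  then have "u = 0" if "u \<in> P \<union> Q" for u
    using that rank_le_0D[of P u] rank_le_0D[of Q u] 0 by blast
  then show ?case by blast
next
  case (Suc p)
  have cut: "rank_le {u \<in> U. dot W u f = 0} (d - 1)"
    if "rank_le U d" "U \<subseteq> {0} \<or> (\<exists>u\<in>U. dot W u f \<noteq> 0)" for U :: "(nat \<Rightarrow> 'f) set" and d f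
    using that(2)
  proof
    assume "U \<subseteq> {0}"
    then show ?thesis by (intro rank_le_zero) blast
  next
    assume "\<exists>u\<in>U. dot W u f \<noteq> 0"
    then obtain u where "u \<in> U" "dot W u f \<noteq> 0" by blast
    then show ?thesis by (rule rank_le_cut[OF that(1)]) (rule dot_add, rule dot_scale)
  qed
  have "\<exists>f. (P \<subseteq> {0} \<or> (\<exists>u\<in>P. dot W u f \<noteq> 0)) \<and> (Q \<subseteq> {0} \<or> (\<exists>u\<in>Q. dot W u f \<noteq> 0))"
  proof -
    have *: "\<exists>f. dot W u f \<noteq> 0 \<and> dot W u' f \<noteq> 0" if "u \<in> P \<union> Q" "u' \<in> P \<union> Q" "u \<noteq> 0" "u' \<noteq> 0" for u u'
      using ex_not_orthogonal[OF assms(1) that(3,4)] Suc.prems(1) that(1,2) by blast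
    show ?thesis
    proof (cases "P \<subseteq> {0} \<or> Q \<subseteq> {0}")
      case True
      show ?thesis
      proof (cases "P \<union> Q \<subseteq> {0}")
        case False
        then obtain u where "u \<in> P \<union> Q" "u \<noteq> 0" by blast
        then show ?thesis using *[of u u] True by blast
      qed simp
    next
      case False
      then obtain u u' where "u \<in> P" "u \<noteq> 0" "u' \<in> Q" "u' \<noteq> 0" by blast
      then show ?thesis using *[of u u'] by blast
    qed
  qed
  then obtain f where f: "(P \<subseteq> {0} \<or> (\<exists>u\<in>P. dot W u f \<noteq> 0)) \<and> (Q \<subseteq> {0} \<or> (\<exists>u\<in>Q. dot W u f \<noteq> 0))"
    by (rule exE)
  note f = conjunct1[OF f] conjunct2[OF f]
  let ?P = "{u \<in> P. dot W u f = 0}" and ?Q = "{u \<in> Q. dot W u f = 0}"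
  have "rank_le ?P (Suc p - 1)" by (rule cut[OF Suc.prems(2) f(1)])
  then have rkP: "rank_le ?P p" unfolding diff_Suc_1 .
  \<comment> \<open>If \<open>q = 0\<close>, then \<open>Q\<close> is already contained in the zero
    space and the truncated \<open>q - 1\<close> is still correct.\<close>
  have rkQ: "rank_le ?Q (q - 1)" by (rule cut[OF Suc.prems(3) f(2)])
  have supp: "\<forall>u\<in>?P \<union> ?Q. \<forall>i. i \<notin> W \<longrightarrow> u i = 0"
    using Suc.prems(1) by blast
  have "q - 1 \<le> p" using Suc.prems(4) by simp
  from Suc.IH[of ?P ?Q "q - 1", OF supp rkP rkQ this] obtain F :: "nat \<Rightarrow> nat \<Rightarrow> 'f" where
    F: "(\<forall>u\<in>?P. (\<forall>j<p. dot W u (F j) = 0) \<longrightarrow> u = 0) \<and> (\<forall>u\<in>?Q. (\<forall>j<q - 1. dot W u (F j) = 0) \<longrightarrow> u = 0)"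
    by (rule exE)
  note F = conjunct1[OF F] conjunct2[OF F]
  let ?F = "case_nat f F"
  have "u = 0" if u: "u \<in> P" "\<forall>j<Suc p. dot W u (?F j) = 0" for u
  proof -
    have "dot W u f = 0" using u(2)[rule_format, of 0] by simp
    moreover have "dot W u (F j) = 0" if "j < p" for j using u(2)[rule_format, of "Suc j"] that by simp
    ultimately show ?thesis using F(1)[rule_format, of u] u(1) by simp
  qed
  moreover have "u = 0" if u: "u \<in> Q" "\<forall>j<q. dot W u (?F j) = 0" for u
  proof (cases q)
    case 0
    then show ?thesis using rank_le_0D[of Q u] Suc.prems(3) u(1) by simp
  next
    case (Suc q')
    then have "dot W u f = 0" using u(2)[rule_format, of 0] by simp
    moreover have "dot W u (F j) = 0" if "j < q - 1" for j using u(2)[rule_format, of "Suc j"] that Suc by simp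
    ultimately show ?thesis using F(2)[rule_format, of u] u(1) by simp
  qed
  ultimately show ?case by (intro exI[of _ ?F]) blast
qed

text \<open>A boundary sums to zero over each component, so it is a combination of the differences
  \<open>delta i - delta (r i)\<close> over the vertices that are not representatives.\<close>

lemma rank_le_boundaries:
  fixes W :: "nat set"
  assumes "finite_graph W E" "component_rep W E r"
  shows "rank_le {contract E z (\<lambda>_. 1 :: 'f::field) | z. True} (card W - card (r ` W))"
proof (rule rank_le_span)
  let ?R = "r ` W"
  let ?T = "(\<lambda>i. delta i - delta (r i) :: nat \<Rightarrow> 'f) ` (W - ?R)"
  have fin: "finite W" using assms by (simp add: finite_graph_def)
  have RW: "?R \<subseteq> W" using assms(2) by (simp add: component_rep_def)
  show "finite ?T" using fin by simp
  show "card ?T \<le> card W - card ?R"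
    using card_image_le[of "W - ?R" "\<lambda>i. delta i - delta (r i) :: nat \<Rightarrow> 'f"] fin RW
    by (simp add: card_Diff_subset finite_subset)
  show "{contract E z (\<lambda>_. 1) | z. True} \<subseteq> fn.span ?T"
  proof
    fix u :: "nat \<Rightarrow> 'f" assume "u \<in> {contract E z (\<lambda>_. 1) | z. True}"
    then obtain z where u: "u = contract E z (\<lambda>_. 1)" by blast
    \<comment> \<open>Pairing with the indicator of a component, which is constant along every
      edge.\<close>
    have comp_sum: "(\<Sum>i\<in>W. u i * (if r i = s then 1 else 0)) = 0" for s
    proof -
      have "pairing E z (\<lambda>_. 1) (\<lambda>i. if r i = s then 1 else 0) = 0"
        unfolding pairing_def
      proof (rule sum.neutral, rule ballI)
        fix e assume e: "e \<in> E"
        then have "{Min e, Max e} \<in> E" using finite_graph_edge(4)[OF assms(1) e] by simp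
        then have "r (Min e) = r (Max e)" using assms(2) by (simp add: component_rep_def)
        then show "z e * (1 * (if r (Max e) = s then 1 else 0) - 1 * (if r (Min e) = s then 1 else 0)) = 0" by simp
      qed
      then show ?thesis unfolding u pairing_eq_sum_contract[OF assms(1)] .
    qed
    have "u = (\<Sum>i\<in>W - ?R. fscale (u i) (delta i - delta (r i)))"
    proof
      fix v
      have rhs: "(\<Sum>i\<in>W - ?R. fscale (u i) (delta i - delta (r i))) v =
          (\<Sum>i\<in>W - ?R. u i * delta i v) - (\<Sum>i\<in>W - ?R. u i * (if r i = v then 1 else 0))"
        by (simp add: sum_fun_apply fscale_apply right_diff_distrib sum_subtractf delta_def eq_commute)
      have one: "(\<Sum>i\<in>W - ?R. u i * delta i v) = (if v \<in> W - ?R then u v else 0)"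
        using fin by (simp add: delta_def if_distrib[of "\<lambda>x. _ * x"] cong: if_cong)
      show "u v = (\<Sum>i\<in>W - ?R. fscale (u i) (delta i - delta (r i))) v"
      proof (cases "v \<in> ?R")
        case True
        then have rv: "r v = v" "v \<in> W" using component_rep_idem[OF assms(2)] RW by auto
        have "0 = (\<Sum>i\<in>?R. u i * (if r i = v then 1 else 0)) + (\<Sum>i\<in>W - ?R. u i * (if r i = v then 1 else 0))"
          using comp_sum[of v] sum.subset_diff[OF RW fin, of "\<lambda>i. u i * (if r i = v then 1 else 0)"]
          by (simp add: add.commute)
        also have "(\<Sum>i\<in>?R. u i * (if r i = v then 1 else 0)) = (\<Sum>i\<in>?R. if i = v then u i else 0)"
        proof (rule sum.cong)
          fix i assume "i \<in> ?R"
          then have "r i = i" using component_rep_idem[OF assms(2)] by auto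
          then show "u i * (if r i = v then 1 else 0) = (if i = v then u i else 0)" by simp
        qed simp
        also have "\<dots> = u v" using True fin by simp
        finally show ?thesis unfolding rhs one using True by (simp add: eq_neg_iff_add_eq_0)
      next
        case False
        then have "(\<Sum>i\<in>W - ?R. u i * (if r i = v then 1 else 0)) = 0" by (intro sum.neutral) auto
        moreover have "u v = 0" if "v \<notin> W" unfolding u by (rule contract_outside[OF assms(1) that])
        ultimately show ?thesis unfolding rhs one using False by auto
      qed
    qed
    also have "\<dots> \<in> fn.span ?T"
      by (intro fn.span_sum fn.span_scale fn.span_base imageI)
    finally show "u \<in> fn.span ?T" .
  qed
qed

text \<open>By the Euler relation the cycle space has dimension \<open>b\<close> over this field
  too, and a linear image cannot be larger.\<close>

lemma rank_le_contract_cycles: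
  fixes y :: "nat \<Rightarrow> 'f::field"
  assumes "finite_graph W E" "component_rep W E r" "b + card W = card E + card (r ` W)"
  shows "rank_le {contract E z y | z. z \<in> cycle_space E} b"
proof -
  obtain r' and B :: "(nat set \<Rightarrow> 'f) set" where B: "component_rep W E r'" "finite B"
    "fn.span B = cycle_space E" "card B + card W = card E + card (r' ` W)"
    using cycle_space_basis[OF assms(1)] by blast
  have "card (r' ` W) = card (r ` W)"
    using num_components_eq[OF B(1)] num_components_eq[OF assms(2)] by simp
  then have "card B = b" using B(4) assms(3) by simp
  let ?T = "(\<lambda>z. contract E z y) ` B"
  have "contract E z y \<in> fn.span ?T" if "z \<in> fn.span B" for z
    using that
  proof (induction rule: fn.span_induct_alt)
    case base
    have "contract E 0 y = 0" by (simp add: contract_def pairing_def fun_eq_iff)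
    then show ?case using fn.span_zero by metis
  next
    case (step a x z)
    show ?case unfolding contract_add contract_scale
      by (intro fn.span_add fn.span_scale fn.span_base imageI step)
  qed
  then have "{contract E z y | z. z \<in> cycle_space E} \<subseteq> fn.span ?T" unfolding B(3) by blast
  moreover have "card ?T \<le> b" using card_image_le[OF B(2)] \<open>card B = b\<close> by blast
  ultimately show ?thesis using B(2) by (intro rank_le_span) auto
qed

text \<open>The index \<open>j = 2\<close> imposes orthogonality to \<open>y\<close> on the
  boundaries. That condition lowers their rank by one because \<open>y\<close> distinguishes the
  endpoints of any edge.\<close>

lemma ex_specialisation:
  fixes y :: "nat \<Rightarrow> 'f::field"
  assumes fg: "finite_graph W E" and "E \<noteq> {}" and rep: "component_rep W E r"
    and b: "b + card W = card E + card (r ` W)" "b + card (r ` W) + 1 \<le> card W"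
    and y: "inj_on y W"
    and ind: "\<And>z. z \<in> cycle_space E \<Longrightarrow> (\<forall>v. contract E z y v = 0) \<Longrightarrow> z = 0"
  shows "\<exists>F :: nat \<Rightarrow> nat \<Rightarrow> 'f. \<forall>z.
    (\<forall>e. e \<notin> E \<longrightarrow> z e = 0) \<longrightarrow>
    (\<forall>j\<in>{2..card W - card (r ` W) + 1}. pairing E z (F 1) (F j) = 0) \<longrightarrow>
    (\<forall>j\<in>{3..b + 2}. pairing E z (F 2) (F j) = 0) \<longrightarrow> z = 0"
proof -
  have fW: "finite W" using fg by (simp add: finite_graph_def)
  \<comment> \<open>The number of indices from 3 to \<open>card W\<close> minus the number of
    components plus 1, that is, of the vectors still free once the first two are fixed.\<close>
  define p where "p = card W - card (r ` W) - 1"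
  have p: "card W - card (r ` W) + 1 = p + 2" "b \<le> p" using b(2) by (simp_all add: p_def)
  let ?one = "\<lambda>_. 1 :: 'f"
  have dotp: "dot W (contract E z f) g = pairing E z f g" for z f and g :: "nat \<Rightarrow> 'f"
    by (simp add: dot_def pairing_eq_sum_contract[OF fg])
  define P1 where "P1 = {contract E z ?one | z. True}"
  define P where "P = {u \<in> P1. dot W u y = 0}"
  define Q where "Q = {contract E z y | z. z \<in> cycle_space E}"
  have "rank_le P (card W - card (r ` W) - 1)"
  proof -
    obtain e where e: "e \<in> E" using assms(2) by blast
    have "dot W (contract E (edge_fun e) ?one) y = y (Max e) - y (Min e)"
    proof -
      have "pairing E (edge_fun e) ?one y = (\<Sum>e'\<in>E. if e' = e then y (Max e') - y (Min e') else 0)"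
        unfolding pairing_def edge_fun_def by (intro sum.cong) auto
      then show ?thesis using e finite_graph_finite[OF fg] by (simp add: dotp)
    qed
    also have "\<dots> \<noteq> 0" using y finite_graph_edge[OF fg e] by (auto simp: inj_on_def)
    finally have nz: "dot W (contract E (edge_fun e) ?one) y \<noteq> 0" .
    have mem: "contract E (edge_fun e) ?one \<in> P1" by (auto simp: P1_def)
    have "rank_le P1 (card W - card (r ` W))" unfolding P1_def by (rule rank_le_boundaries[OF fg rep])
    then show ?thesis unfolding P_def
      by (rule rank_le_cut[OF _ mem, where \<phi> = "\<lambda>u. dot W u y"]) (rule nz, rule dot_add, rule dot_scale)
  qed
  then have rkP: "rank_le P p" by (simp add: p_def)
  have rkQ: "rank_le Q b" unfolding Q_def by (rule rank_le_contract_cycles[OF fg rep b(1)])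
  have supp: "\<forall>u\<in>P \<union> Q. \<forall>i. i \<notin> W \<longrightarrow> u i = 0"
    using contract_outside[OF fg] by (auto simp: P_def P1_def Q_def)
  from ex_separating[of W P Q p b, OF fW supp rkP rkQ p(2)] obtain G :: "nat \<Rightarrow> nat \<Rightarrow> 'f" where
    G: "(\<forall>u\<in>P. (\<forall>j<p. dot W u (G j) = 0) \<longrightarrow> u = 0) \<and> (\<forall>u\<in>Q. (\<forall>j<b. dot W u (G j) = 0) \<longrightarrow> u = 0)"
    by (rule exE)
  note G = conjunct1[OF G] conjunct2[OF G]
  \<comment> \<open>The separating sequence starts at index 3. Its first \<open>b\<close> members
    are \<open>F 3\<close> to \<open>F (b + 2)\<close>, the ones that are also paired with
    \<open>F 2\<close>.\<close>
  define F where "F = (\<lambda>j. if j = 1 then ?one else if j = 2 then y else G (j - 3))"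
  have "z = 0" if z: "\<forall>e. e \<notin> E \<longrightarrow> z e = 0"
    "\<forall>j\<in>{2..card W - card (r ` W) + 1}. pairing E z (F 1) (F j) = 0"
    "\<forall>j\<in>{3..b + 2}. pairing E z (F 2) (F j) = 0" for z
  proof -
    let ?u = "contract E z ?one"
    have "dot W ?u y = 0" using z(2)[rule_format, of 2] unfolding p dotp by (simp add: F_def)
    then have "?u \<in> P" by (auto simp: P_def P1_def)
    moreover have "dot W ?u (G j) = 0" if "j < p" for j
      using z(2)[rule_format, of "j + 3"] that unfolding p dotp by (simp add: F_def)
    ultimately have "?u = 0" using G(1) by blast
    then have zc: "z \<in> cycle_space E" using z(1) by (simp add: cycle_space_def)
    then have "contract E z y \<in> Q" by (auto simp: Q_def)
    moreover have "dot W (contract E z y) (G j) = 0" if "j < b" for j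
      using z(3)[rule_format, of "j + 3"] that unfolding dotp by (simp add: F_def)
    ultimately have "contract E z y = 0" using G(2) by blast
    then show "z = 0" using ind[OF zc] by simp
  qed
  then show ?thesis by blast
qed

section \<open>Coordinates of exterior products\<close>

lemma wedge_nonzeroD:
  assumes "wedge x y C \<noteq> 0"
  shows "finite C \<and> (\<exists>A\<subseteq>C. x A \<noteq> 0 \<and> y (C - A) \<noteq> 0)"
proof -
  have "finite (Pow C)" using assms unfolding wedge_def by (meson sum.infinite)
  moreover obtain A where "A \<in> Pow C" "wedge_sign A (C - A) * x A * y (C - A) \<noteq> 0"
    using assms unfolding wedge_def by (meson sum.neutral)
  ultimately show ?thesis by auto
qed

lemma f_vec_single: "f_vec n X i {j} = (if j \<in> {1..n} then X i j else 0)"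
proof -
  have "f_vec n X i {j} = (\<Sum>j'\<in>{1..n}. if j = j' then X i j' else 0)"
    unfolding f_vec_def sum_fun_apply by (intro sum.cong) (simp_all add: fscale_apply e_base_def)
  then show ?thesis by simp
qed

lemma f_vec_nonzeroD:
  assumes "f_vec n X i A \<noteq> 0"
  shows "\<exists>j\<in>{1..n}. A = {j}"
proof -
  obtain j where "j \<in> {1..n}" "fscale (X i j) (e_base {j}) A \<noteq> 0"
    using assms unfolding f_vec_def sum_fun_apply by (meson sum.neutral)
  then show ?thesis by (auto simp: fscale_apply e_base_def split: if_splits)
qed

lemma foldr_wedge_support:
  assumes "foldr wedge (map (f_vec n X) l) (e_base {}) C \<noteq> 0"
  shows "finite C \<and> C \<subseteq> {1..n} \<and> card C = length l"
  using assms
proof (induction l arbitrary: C)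
  case Nil
  then show ?case by (simp add: e_base_def split: if_splits)
next
  case (Cons i l)
  then obtain A where A: "finite C" "A \<subseteq> C" "f_vec n X i A \<noteq> 0"
    "foldr wedge (map (f_vec n X) l) (e_base {}) (C - A) \<noteq> 0"
    using wedge_nonzeroD[of "f_vec n X i" "foldr wedge (map (f_vec n X) l) (e_base {})" C] by auto
  obtain j where j: "j \<in> {1..n}" "A = {j}" using f_vec_nonzeroD[OF A(3)] by blast
  have "C - A \<subseteq> {1..n}" "card (C - A) = length l" using Cons.IH[OF A(4)] by auto
  moreover have "card C = Suc (card (C - A))" using card.remove[OF A(1), of j] A(2) j(2) by simp
  ultimately show ?case using A(1) j by auto
qed

lemma f_base_support:
  assumes "finite B" "f_base n X B C \<noteq> 0"
  shows "finite C" "C \<subseteq> {1..n}" "card C = card B"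
  using foldr_wedge_support[of n X "sorted_list_of_set B" C] assms by (auto simp: f_base_def)

lemma wedge_sign_empty: "wedge_sign A {} = 1"
  by (simp add: wedge_sign_def)

lemma wedge_unit:
  assumes "finite C"
  shows "wedge x (e_base {}) C = x C"
proof -
  have "wedge x (e_base {}) C = (\<Sum>A\<in>Pow C. if A = C then x A else 0)"
    unfolding wedge_def
  proof (rule sum.cong)
    fix A assume "A \<in> Pow C"
    then show "wedge_sign A (C - A) * x A * e_base {} (C - A) = (if A = C then x A else 0)"
      by (auto simp: e_base_def wedge_sign_empty)
  qed simp
  then show ?thesis using assms by simp
qed

lemma f_base_single:
  assumes "j \<in> {1..n}"
  shows "f_base n X {i} {j} = X i j"
  using assms by (simp add: f_base_def wedge_unit f_vec_single)

text \<open>Only the two singletons contribute to the product, and the inversion of \<open>q\<close>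
  before \<open>p\<close> gives the minus sign of a 2 by 2 minor.\<close>

lemma f_base_pair:
  assumes "i < j" "p < q" "p \<in> {1..n}" "q \<in> {1..n}"
  shows "f_base n X {i, j} {p, q} = X i p * X j q - X i q * X j p"
proof -
  have "sorted_list_of_set {i, j} = [i, j]" using assms(1) by (simp add: sorted_list_of_set_insert_remove)
  then have "f_base n X {i, j} {p, q} = (\<Sum>A\<in>Pow {p, q}. wedge_sign A ({p, q} - A) * f_vec n X i A *
      f_vec n X j ({p, q} - A))"
    unfolding f_base_def by (simp add: wedge_def[of "f_vec n X i"] wedge_unit)
  also have "\<dots> = (\<Sum>A\<in>{{p}, {q}}. wedge_sign A ({p, q} - A) * f_vec n X i A * f_vec n X j ({p, q} - A))"
  proof (rule sum.mono_neutral_right)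
    show "\<forall>A\<in>Pow {p, q} - {{p}, {q}}. wedge_sign A ({p, q} - A) * f_vec n X i A * f_vec n X j ({p, q} - A) = 0"
      using f_vec_nonzeroD[of n X i] by fastforce
  qed auto
  also have "\<dots> = wedge_sign {p} {q} * X i p * X j q + wedge_sign {q} {p} * X i q * X j p"
  proof -
    have "{p, q} - {p} = {q}" "{p, q} - {q} = {p}" "{p} \<noteq> {q}" using assms(2) by auto
    then show ?thesis using assms(3,4) by (simp add: f_vec_single)
  qed
  also have "\<dots> = 1 * X i p * X j q + (- 1) * X i q * X j p"
  proof -
    have "{(a, b). a \<in> {p} \<and> b \<in> {q} \<and> b < a} = {}" "{(a, b). a \<in> {q} \<and> b \<in> {p} \<and> b < a} = {(q, p)}"
      using assms(2) by auto
    then have "wedge_sign {p} {q} = (1 :: 'a)" "wedge_sign {q} {p} = (- 1 :: 'a)"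
      unfolding wedge_sign_def by (simp_all only: card.empty power_0 card_1_singleton_iff) simp
    then show ?thesis by simp
  qed
  finally show ?thesis by simp
qed

lemma in_span_support:
  assumes "x \<in> fn.span S" "\<And>s. s \<in> S \<Longrightarrow> s A = 0"
  shows "x A = 0"
  using assms(1) by (induction rule: fn.span_induct_alt) (auto simp: fscale_apply assms(2))

text \<open>Modulo the basis vectors of non-faces only the coordinates at faces remain. The support
  assumptions keep \<open>x - s\<close> within the subsets of \<open>{1..n}\<close>, where those
  basis vectors live.\<close>

lemma in_quotient_span_iff:
  assumes "\<And>A. \<not> A \<subseteq> {1..n} \<Longrightarrow> x A = 0" "\<And>s A. s \<in> S \<Longrightarrow> \<not> A \<subseteq> {1..n} \<Longrightarrow> s A = 0"
  shows "in_quotient_span n K x S \<longleftrightarrow> (\<exists>s\<in>fn.span S. \<forall>A\<in>K. x A = s A)"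
proof -
  have "x - s \<in> fn.span {e_base A | A. A \<subseteq> {1..n} \<and> A \<notin> K} \<longleftrightarrow> (\<forall>A\<in>K. x A = s A)"
    if s: "s \<in> fn.span S" for s
  proof
    assume xs: "x - s \<in> fn.span {e_base A | A. A \<subseteq> {1..n} \<and> A \<notin> K}"
    show "\<forall>A\<in>K. x A = s A"
    proof
      fix A assume "A \<in> K"
      then have "(x - s) A = 0" by (intro in_span_support[OF xs]) (auto simp: e_base_def)
      then show "x A = s A" by simp
    qed
  next
    assume K: "\<forall>A\<in>K. x A = s A"
    let ?I = "Pow {1..n} - K"
    have "x - s = (\<Sum>A\<in>?I. fscale ((x - s) A) (e_base A))"
    proof
      fix C
      have "(\<Sum>A\<in>?I. fscale ((x - s) A) (e_base A)) C = (\<Sum>A\<in>?I. if C = A then (x - s) A else 0)"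
        unfolding sum_fun_apply by (intro sum.cong) (simp_all add: fscale_apply e_base_def)
      also have "\<dots> = (if C \<in> ?I then (x - s) C else 0)" by simp
      also have "\<dots> = (x - s) C"
      proof (cases "C \<subseteq> {1..n}")
        case False
        then have "x C = 0" "s C = 0" using assms(1) in_span_support[OF s] assms(2) by blast+
        then show ?thesis by simp
      qed (use K in auto)
      finally show "(x - s) C = (\<Sum>A\<in>?I. fscale ((x - s) A) (e_base A)) C" by simp
    qed
    also have "\<dots> \<in> fn.span {e_base A | A. A \<subseteq> {1..n} \<and> A \<notin> K}"
      by (intro fn.span_sum fn.span_scale fn.span_base) auto
    finally show "x - s \<in> fn.span {e_base A | A. A \<subseteq> {1..n} \<and> A \<notin> K}" .
  qed
  then show ?thesis unfolding in_quotient_span_def by blast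
qed

section \<open>Pairs in lexicographic order and spans of edge functions\<close>

lemma card_2_Min_Max:
  fixes A :: "nat set"
  assumes "card A = 2"
  shows "A = {Min A, Max A}" "Min A < Max A"
proof -
  obtain a b where "A = {a, b}" "a \<noteq> b" using assms unfolding card_2_iff by blast
  then show "A = {Min A, Max A}" "Min A < Max A" by (auto simp: min_def max_def)
qed

lemma lex_less_pair_iff:
  assumes "card A = 2" "card B = 2"
  shows "lex_less A B \<longleftrightarrow> Min A < Min B \<or> (Min A = Min B \<and> Max A < Max B)"
proof -
  note A = card_2_Min_Max[OF assms(1)] and B = card_2_Min_Max[OF assms(2)]
  have "lex_less A B \<longleftrightarrow> lex_le_pair A (Min B) (Max B) \<and> A \<noteq> B"
    using lex_le_pair_iff[OF assms(1) B(2)] B(1) by (auto simp: lex_less_def)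
  moreover have "A = B \<longleftrightarrow> Min A = Min B \<and> Max A = Max B" using A(1) B(1) by metis
  ultimately show ?thesis by (auto simp: lex_le_pair_def)
qed

definition restrict_to :: "nat set set \<Rightarrow> (nat set \<Rightarrow> 'f::field) \<Rightarrow> nat set \<Rightarrow> 'f" where
  "restrict_to E x = (\<lambda>e. if e \<in> E then x e else 0)"

lemma restrict_to_add: "restrict_to E (x + y) = restrict_to E x + restrict_to E y"
  by (auto simp: restrict_to_def fun_eq_iff)

lemma restrict_to_scale: "restrict_to E (fscale a x) = fscale a (restrict_to E x)"
  by (auto simp: restrict_to_def fun_eq_iff fscale_apply)

lemma restrict_to_span: "restrict_to E ` fn.span S = fn.span (restrict_to E ` S)"
proof -
  have "module_hom fscale fscale (restrict_to E :: _ \<Rightarrow> nat set \<Rightarrow> 'a)"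
    by unfold_locales (simp_all add: restrict_to_add restrict_to_scale)
  then show ?thesis by (rule module_hom.span_image[symmetric])
qed

text \<open>A vector of \<open>T\<close> outside the span of \<open>S\<close> would extend
  \<open>S\<close> to an independent set larger than \<open>T\<close> inside the span of
  \<open>T\<close>.\<close>

lemma span_eq_of_card:
  assumes "finite T" "fn.independent S" "S \<subseteq> fn.span T" "card T \<le> card S"
  shows "fn.span T \<subseteq> fn.span S"
proof -
  have "t \<in> fn.span S" if t: "t \<in> T" for t
  proof (rule ccontr)
    assume nt: "t \<notin> fn.span S"
    have "fn.independent (insert t S)" using nt assms(2) by (rule fn.independent_insertI)
    moreover have "insert t S \<subseteq> fn.span T" using assms(3) t fn.span_base by blast
    ultimately have "finite (insert t S) \<and> card (insert t S) \<le> card T"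
      by (intro fn.independent_span_bound[OF assms(1)])
    moreover have "t \<notin> S" using nt fn.span_base by blast
    ultimately show False using assms(4) by (auto simp: card_insert_if)
  qed
  then have "T \<subseteq> fn.span S" by (rule subsetI)
  then show ?thesis using fn.subspace_span by (rule fn.span_minimal)
qed

text \<open>Passes from coefficients indexed by \<open>D\<close>, as the determinant argument
  delivers them, to independence of a set. Injectivity is recorded because cardinalities are
  compared later.\<close>

lemma independent_family:
  assumes "finite D" "\<And>a d. (\<And>e. (\<Sum>d\<in>D. a d * w d e) = 0) \<Longrightarrow> d \<in> D \<Longrightarrow> a d = 0"
  shows "inj_on w D" "fn.independent (w ` D)"
proof -
  show inj: "inj_on w D"
  proof (rule inj_onI, rule ccontr)
    fix d d' assume d: "d \<in> D" "d' \<in> D" "w d = w d'" "d \<noteq> d'"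
    define a where "a = (\<lambda>x. if x = d then 1 else if x = d' then - 1 else 0 :: 'b)"
    have "(\<Sum>x\<in>D. a x * w x e) = 0" for e
    proof -
      have "(\<Sum>x\<in>D. a x * w x e) = (\<Sum>x\<in>{d, d'}. a x * w x e)"
        using d assms(1) by (intro sum.mono_neutral_right) (auto simp: a_def)
      then show ?thesis using d by (simp add: a_def)
    qed
    then have "a d = 0" using assms(2)[of a d] d(1) by blast
    then show False by (simp add: a_def)
  qed
  show "fn.independent (w ` D)"
  proof (rule fn.independent_if_scalars_zero)
    show "finite (w ` D)" using assms(1) by simp
    fix f x assume f: "(\<Sum>x\<in>w ` D. fscale (f x) x) = 0" and x: "x \<in> w ` D"
    have "(\<Sum>d\<in>D. f (w d) * w d e) = 0" for e
    proof -
      have "(\<Sum>d\<in>D. f (w d) * w d e) = (\<Sum>x\<in>w ` D. fscale (f x) x) e"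
        unfolding sum_fun_apply by (simp add: sum.reindex[OF inj] fscale_apply)
      then show ?thesis using f by simp
    qed
    then show "f x = 0" using assms(2)[of "\<lambda>d. f (w d)"] x by blast
  qed
qed

text \<open>The restriction of \<open>x \<and> v\<close> to \<open>E\<close>.\<close>
definition edge_minor :: "nat set set \<Rightarrow> (nat \<Rightarrow> 'f::field) \<Rightarrow> (nat \<Rightarrow> 'f) \<Rightarrow> nat set \<Rightarrow> 'f" where
  "edge_minor E x v = (\<lambda>e. if e \<in> E then x (Min e) * v (Max e) - x (Max e) * v (Min e) else 0)"

text \<open>
  The restrictions of \<open>x\<close> to the components are annihilated by \<open>x \<and> -\<close>, which is used to make
  \<open>v\<close> vanish at the representatives.
\<close>
lemma edge_minor_span:
  assumes fg: "finite_graph W E" and rep: "component_rep W E r" and x: "\<And>i. i \<in> W \<Longrightarrow> x i \<noteq> 0"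
  shows "edge_minor E x v \<in> fn.span ((\<lambda>i. edge_minor E x (delta i)) ` (W - r ` W))"
proof -
  have fW: "finite W" using fg by (simp add: finite_graph_def)
  define v' where "v' = (\<lambda>i. v i - v (r i) / x (r i) * x i)"
  have v'0: "v' i = 0" if "i \<in> r ` W" for i
  proof -
    have "i \<in> W" "r i = i" using that rep component_rep_idem[OF rep] by (auto simp: component_rep_def)
    then show ?thesis using x by (simp add: v'_def)
  qed
  have "edge_minor E x v = (\<Sum>i\<in>W - r ` W. fscale (v' i) (edge_minor E x (delta i)))"
  proof
    fix e
    show "edge_minor E x v e = (\<Sum>i\<in>W - r ` W. fscale (v' i) (edge_minor E x (delta i))) e"
    proof (cases "e \<in> E")
      case True
      note e = finite_graph_edge[OF fg True]
      have "{Min e, Max e} \<in> E" using e(4) True by simp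
      then have r: "r (Min e) = r (Max e)" using rep by (simp add: component_rep_def)
      have val: "(\<Sum>i\<in>W - r ` W. v' i * delta i j) = v' j" if "j \<in> W" for j
      proof -
        have "(\<Sum>i\<in>W - r ` W. v' i * delta i j) = (\<Sum>i\<in>W. v' i * delta i j)"
          using fW v'0 by (intro sum.mono_neutral_left) auto
        also have "\<dots> = v' j" using that fW by (simp add: delta_def if_distrib[of "\<lambda>x. _ * x"] cong: if_cong)
        finally show ?thesis .
      qed
      have "(\<Sum>i\<in>W - r ` W. fscale (v' i) (edge_minor E x (delta i))) e =
          x (Min e) * (\<Sum>i\<in>W - r ` W. v' i * delta i (Max e)) - x (Max e) * (\<Sum>i\<in>W - r ` W. v' i * delta i (Min e))"
        using True by (simp add: sum_fun_apply fscale_apply edge_minor_def sum_distrib_left right_diff_distrib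
            sum_subtractf mult.left_commute)
      also have "\<dots> = x (Min e) * v' (Max e) - x (Max e) * v' (Min e)" using val e by simp
      \<comment> \<open>Both endpoints share a representative, so the subtracted multiples of
        \<open>x\<close> carry the same factor and cancel in the minor.\<close>
      also have "\<dots> = edge_minor E x v e" using True by (simp add: edge_minor_def v'_def r algebra_simps)
      finally show ?thesis by simp
    qed (simp add: sum_fun_apply fscale_apply edge_minor_def)
  qed
  also have "\<dots> \<in> fn.span ((\<lambda>i. edge_minor E x (delta i)) ` (W - r ` W))"
    by (intro fn.span_sum fn.span_scale fn.span_base imageI)
  finally show ?thesis .
qed

lemma edge_minor_in_span:
  assumes "finite E"
  shows "edge_minor E x v \<in> fn.span (edge_fun ` E)"
proof -
  have "edge_minor E x v = (\<Sum>e\<in>E. fscale (edge_minor E x v e) (edge_fun e))"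
  proof
    fix e'
    have "(\<Sum>e\<in>E. fscale (edge_minor E x v e) (edge_fun e)) e' = (\<Sum>e\<in>E. if e' = e then edge_minor E x v e else 0)"
      unfolding sum_fun_apply by (intro sum.cong) (simp_all add: fscale_apply edge_fun_def)
    then show "edge_minor E x v e' = (\<Sum>e\<in>E. fscale (edge_minor E x v e) (edge_fun e)) e'"
      using assms by (simp add: edge_minor_def)
  qed
  also have "\<dots> \<in> fn.span (edge_fun ` E)"
    by (intro fn.span_sum fn.span_scale fn.span_base imageI)
  finally show ?thesis .
qed

section \<open>The shifted complex\<close>

definition shifted_edges :: "nat \<Rightarrow> nat \<Rightarrow> nat set set" where
  "shifted_edges m b = {A. A \<subseteq> {1..m} \<and> card A = 2 \<and> lex_le_pair A 2 (b + 2)}"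

lemma shifted_edges_iff:
  "A \<in> shifted_edges m b \<longleftrightarrow>
    card A = 2 \<and> Max A \<le> m \<and> (Min A = 1 \<or> (Min A = 2 \<and> Max A \<le> b + 2))"
proof (cases "card A = 2")
  case True
  note A = card_2_Min_Max[OF True]
  have "A \<subseteq> {1..m} \<longleftrightarrow> 1 \<le> Min A \<and> Max A \<le> m"
    by (subst A(1)) (use A(2) in auto)
  then show ?thesis using True unfolding shifted_edges_def lex_le_pair_def by auto
qed (simp add: shifted_edges_def)

lemma shifted_edges_eq:
  assumes "b + 2 \<le> m"
  shows "shifted_edges m b = (\<lambda>j. {1, j}) ` {2..m} \<union> (\<lambda>j. {2, j}) ` {3..b + 2}"
proof (intro equalityI subsetI)
  fix A assume A: "A \<in> shifted_edges m b"
  then have "card A = 2" by (simp add: shifted_edges_iff)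
  note c = card_2_Min_Max[OF this]
  have "Min A = 1 \<and> Max A \<in> {2..m} \<or> Min A = 2 \<and> Max A \<in> {3..b + 2}"
    using A c(2) by (auto simp: shifted_edges_iff)
  then show "A \<in> (\<lambda>j. {1, j}) ` {2..m} \<union> (\<lambda>j. {2, j}) ` {3..b + 2}"
  proof
    assume "Min A = 1 \<and> Max A \<in> {2..m}"
    then show ?thesis using c(1) by (intro UnI1 image_eqI[of _ _ "Max A"]) auto
  next
    assume "Min A = 2 \<and> Max A \<in> {3..b + 2}"
    then show ?thesis using c(1) by (intro UnI2 image_eqI[of _ _ "Max A"]) auto
  qed
next
  fix A :: "nat set" assume "A \<in> (\<lambda>j. {1, j}) ` {2..m} \<union> (\<lambda>j. {2, j}) ` {3..b + 2}"
  then obtain i j where ij: "A = {i, j}" "i < j" "j \<le> m" "i = 1 \<or> i = 2 \<and> j \<le> b + 2"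
    using assms by auto
  then have "card A = 2" "Min A = i" "Max A = j" by auto
  then show "A \<in> shifted_edges m b" using ij by (auto simp: shifted_edges_iff)
qed

text \<open>For \<open>m = n - c + 1\<close> the count is \<open>n - c + b\<close>, the number of
  edges of the refinement.\<close>

lemma card_shifted_edges:
  assumes "b + 2 \<le> m"
  shows "card (shifted_edges m b) + 1 = m + b" "finite (shifted_edges m b)"
proof -
  have 1: "card ((\<lambda>j. {1, j}) ` {2..m}) = m - 1"
    by (subst card_image) (auto simp: inj_on_def doubleton_eq_iff)
  have 2: "card ((\<lambda>j. {2, j}) ` {3..b + 2}) = b"
    by (subst card_image) (auto simp: inj_on_def doubleton_eq_iff)
  have "(\<lambda>j. {1 :: nat, j}) ` {2..m} \<inter> (\<lambda>j. {2, j}) ` {3..b + 2} = {}"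
  proof -
    have "1 \<in> A" if "A \<in> (\<lambda>j. {1 :: nat, j}) ` {2..m}" for A using that by auto
    moreover have "1 \<notin> A" if "A \<in> (\<lambda>j. {2 :: nat, j}) ` {3..b + 2}" for A using that by auto
    ultimately show ?thesis by blast
  qed
  from card_Un_disjoint[OF _ _ this] have "card (shifted_edges m b) = (m - 1) + b"
    unfolding shifted_edges_eq[OF assms] 1 2 by simp
  then show "card (shifted_edges m b) + 1 = m + b" using assms by simp
  show "finite (shifted_edges m b)" unfolding shifted_edges_eq[OF assms] by simp
qed

lemma f_base_restrict:
  assumes fg: "finite_graph {1..n} E" and A: "card A = 2"
  shows "restrict_to E (f_base n X A) = edge_minor E (X (Min A)) (X (Max A))"
proof
  fix e
  show "restrict_to E (f_base n X A) e = edge_minor E (X (Min A)) (X (Max A)) e"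
  proof (cases "e \<in> E")
    case True
    note e = finite_graph_edge[OF fg True] and c = card_2_Min_Max[OF A]
    have "f_base n X A e = f_base n X {Min A, Max A} {Min e, Max e}" using c(1) e(4) by simp
    also have "\<dots> = X (Min A) (Min e) * X (Max A) (Max e) - X (Min A) (Max e) * X (Max A) (Min e)"
      by (rule f_base_pair[OF c(2) e(3,1,2)])
    finally show ?thesis using True by (simp add: restrict_to_def edge_minor_def)
  qed (simp add: restrict_to_def edge_minor_def)
qed

text \<open>Products of two vectors have no coordinates at the empty face or at vertices, so
  membership in the quotient is decided on the edges alone.\<close>

lemma in_quotient_span_pair_iff:
  fixes X :: "nat \<Rightarrow> nat \<Rightarrow> 'f::field"
  assumes fg: "finite_graph {1..n} E" and B: "card B = 2" "B \<subseteq> {1..n}"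
  shows "in_quotient_span n (graph_complex ({1..n}, E)) (f_base n X B)
      {f_base n X A | A. A \<subseteq> {1..n} \<and> card A = card B \<and> lex_less A B} \<longleftrightarrow>
    edge_minor E (X (Min B)) (X (Max B)) \<in>
      fn.span ((\<lambda>A. edge_minor E (X (Min A)) (X (Max A))) ` {A. A \<subseteq> {1..n} \<and> card A = 2 \<and> lex_less A B})"
proof -
  let ?L = "{A. A \<subseteq> {1..n} \<and> card A = 2 \<and> lex_less A B}"
  let ?S = "f_base n X ` ?L"
  have S: "{f_base n X A | A. A \<subseteq> {1..n} \<and> card A = card B \<and> lex_less A B} = ?S" using B by auto
  have supp: "f_base n X A C = 0" if "card A = 2" "\<not> (C \<subseteq> {1..n} \<and> card C = 2)" for A C
    using f_base_support[of A n X C] that card.infinite[of A] by fastforce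
  have iff: "(\<forall>A\<in>graph_complex ({1..n}, E). f_base n X B A = s A) \<longleftrightarrow>
      restrict_to E (f_base n X B) = restrict_to E s" if s: "s \<in> fn.span ?S" for s
  proof -
    have "f_base n X B A = s A" if "A \<in> {{}} \<union> {{v} | v. v \<in> {1..n}}" for A
    proof -
      have "card A \<noteq> 2" using that by auto
      then have "f_base n X B A = 0" using supp[OF B(1)] by blast
      moreover have "s A = 0" by (rule in_span_support[OF s]) (use \<open>card A \<noteq> 2\<close> supp in blast)
      ultimately show ?thesis by simp
    qed
    then have "(\<forall>A\<in>graph_complex ({1..n}, E). f_base n X B A = s A) \<longleftrightarrow> (\<forall>A\<in>E. f_base n X B A = s A)"
      unfolding graph_complex_def by (auto simp del: singleton_conv)
    also have "\<dots> \<longleftrightarrow> restrict_to E (f_base n X B) = restrict_to E s"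
      by (auto simp: restrict_to_def fun_eq_iff)
    finally show ?thesis .
  qed
  have "in_quotient_span n (graph_complex ({1..n}, E)) (f_base n X B) ?S \<longleftrightarrow>
      (\<exists>s\<in>fn.span ?S. \<forall>A\<in>graph_complex ({1..n}, E). f_base n X B A = s A)"
    by (rule in_quotient_span_iff) (use supp B in blast)+
  also have "\<dots> \<longleftrightarrow> (\<exists>s\<in>fn.span ?S. restrict_to E (f_base n X B) = restrict_to E s)"
    using iff by blast
  also have "\<dots> \<longleftrightarrow> restrict_to E (f_base n X B) \<in> fn.span (restrict_to E ` ?S)"
    unfolding restrict_to_span[symmetric] by blast
  also have "restrict_to E ` ?S = (\<lambda>A. edge_minor E (X (Min A)) (X (Max A))) ` ?L"
    unfolding image_image by (rule image_cong) (auto simp: f_base_restrict[OF fg])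
  finally show ?thesis unfolding S f_base_restrict[OF fg B(1)] .
qed

text \<open>By the edge count, the assumption \<open>pairs\<close> makes the claimed products a
  basis. A claimed pair is not spanned by its predecessors, since these lie in the span of the other
  claimed products. A pair that is not claimed comes after enough claimed ones to be spanned: after
  those with minimum 1 if its own minimum is 1, and after all of them otherwise.\<close>

lemma exterior_shifting_eq:
  fixes X :: "nat \<Rightarrow> nat \<Rightarrow> 'f::field"
  assumes fg: "finite_graph {1..n} E" and rep: "component_rep {1..n} E r" and c: "c = card (r ` {1..n})"
    and b: "b + n = card E + c" "b + c + 1 \<le> n"
    and row1: "\<And>i. i \<in> {1..n} \<Longrightarrow> X 1 i \<noteq> 0"
    and rows: "\<And>a i. (\<And>p. p \<in> {1..n} \<Longrightarrow> (\<Sum>i\<in>{1..n}. a i * X i p) = 0) \<Longrightarrow> i \<in> {1..n} \<Longrightarrow> a i = 0"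
    and pairs: "\<And>a A. (\<And>e. e \<in> E \<Longrightarrow> (\<Sum>A\<in>shifted_edges (n - c + 1) b. a A * edge_minor E (X (Min A)) (X (Max A)) e) = 0)
        \<Longrightarrow> A \<in> shifted_edges (n - c + 1) b \<Longrightarrow> a A = 0"
  shows "exterior_shifting n X (graph_complex ({1..n}, E)) = Delta_top b c n"
proof -
  let ?m = "n - c + 1"
  let ?D = "shifted_edges ?m b"
  let ?K = "graph_complex ({1..n}, E)"
  let ?low = "\<lambda>B. {f_base n X A | A. A \<subseteq> {1..n} \<and> card A = card B \<and> lex_less A B}"
  define w where "w = (\<lambda>A. edge_minor E (X (Min A)) (X (Max A)))"
  have fE: "finite E" using fg by (rule finite_graph_finite)
  have m: "b + 2 \<le> ?m" "?m \<le> n"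
  proof -
    have "c > 0"
    proof -
      have "r ` {1..n} \<noteq> {}" using b(2) by simp
      then show ?thesis unfolding c by (simp add: card_gt_0_iff)
    qed
    then show "b + 2 \<le> ?m" "?m \<le> n" using b(2) by simp_all
  qed
  have fD: "finite ?D" and cD: "card ?D = card E"
    using card_shifted_edges[OF m(1)] b by simp_all
  have inj: "inj_on w ?D" and ind: "fn.independent (w ` ?D)"
    using independent_family[OF fD, of w] pairs unfolding w_def by blast+
  have full: "w A \<in> fn.span (w ` ?D)" for A
  proof -
    have "fn.span (edge_fun ` E) \<subseteq> fn.span (w ` ?D)"
    proof (rule span_eq_of_card[OF _ ind])
      show "w ` ?D \<subseteq> fn.span (edge_fun ` E)" using edge_minor_in_span[OF fE] by (auto simp: w_def)
      show "card (edge_fun ` E) \<le> card (w ` ?D)"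
        unfolding card_image[OF inj] cD by (rule card_image_le[OF fE])
    qed (use fE in simp)
    then show ?thesis using edge_minor_in_span[OF fE] unfolding w_def by blast
  qed
  define D1 where "D1 = (\<lambda>j. {1 :: nat, j}) ` {2..?m}"
  have D1: "D1 \<subseteq> ?D" unfolding D1_def shifted_edges_eq[OF m(1)] by blast
  \<comment> \<open>The \<open>n - c\<close> products over \<open>D1\<close> are independent and
    exhaust the rank of multiplication by the first vector. They therefore span the products with
    maximum beyond \<open>?m\<close> as well.\<close>
  have first: "w A \<in> fn.span (w ` D1)" if "Min A = 1" for A
  proof -
    let ?T = "(\<lambda>i. edge_minor E (X 1) (delta i)) ` ({1..n} - r ` {1..n})"
    have span_T: "edge_minor E (X 1) v \<in> fn.span ?T" for v
      by (rule edge_minor_span[OF fg rep row1])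
    have RW: "r ` {1..n} \<subseteq> {1..n}" using rep by (simp add: component_rep_def)
    have "fn.span ?T \<subseteq> fn.span (w ` D1)"
    proof (rule span_eq_of_card)
      show "fn.independent (w ` D1)" using ind D1 by (meson fn.independent_mono image_mono)
      have "Min A = 1" if "A \<in> D1" for A using that by (auto simp: D1_def)
      then show "w ` D1 \<subseteq> fn.span ?T" using span_T by (auto simp: w_def)
      have "card D1 = n - c" unfolding D1_def
        by (subst card_image) (auto simp: inj_on_def doubleton_eq_iff)
      then have "card (w ` D1) = n - c" using inj_on_subset[OF inj D1] by (simp add: card_image)
      moreover have "card ?T \<le> card ({1..n} - r ` {1..n})" by (rule card_image_le) simp
      moreover have "card ({1..n} - r ` {1..n}) = n - c" unfolding c using RW by (simp add: card_Diff_subset)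
      ultimately show "card ?T \<le> card (w ` D1)" by simp
    qed simp
    then show ?thesis using span_T that unfolding w_def by auto
  qed
  have pair: "B \<in> exterior_shifting n X ?K \<longleftrightarrow> B \<in> ?D" if B: "card B = 2" "B \<subseteq> {1..n}" for B
  proof -
    let ?L = "{A. A \<subseteq> {1..n} \<and> card A = 2 \<and> lex_less A B}"
    note cB = card_2_Min_Max[OF B(1)]
    have rB: "1 \<le> Min B" "Max B \<le> n" using B(2) cB by auto
    have less: "A \<in> ?L \<longleftrightarrow> A \<subseteq> {1..n} \<and> card A = 2 \<and> (Min A < Min B \<or> Min A = Min B \<and> Max A < Max B)" for A
      using lex_less_pair_iff[OF _ B(1)] by blast
    have iff: "B \<in> exterior_shifting n X ?K \<longleftrightarrow> w B \<notin> fn.span (w ` ?L)"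
      using in_quotient_span_pair_iff[OF fg B] B unfolding exterior_shifting_def w_def by simp
    have Dsub: "A \<subseteq> {1..n}" "card A = 2" if "A \<in> ?D" for A
      using that m(2) unfolding shifted_edges_def by auto
    have D1_min: "Min A = 1" if "A \<in> D1" for A using that by (auto simp: D1_def)
    show ?thesis
    proof (cases "B \<in> ?D")
      case True
      then have Bc: "Max B \<le> ?m" "Min B = 1 \<or> Min B = 2 \<and> Max B \<le> b + 2" by (simp_all add: shifted_edges_iff)
      have "w ` ?L \<subseteq> fn.span (w ` (?D - {B}))"
      proof
        fix y assume "y \<in> w ` ?L"
        then obtain A where A: "A \<in> ?L" "y = w A" by blast
        then have A': "card A = 2" "A \<subseteq> {1..n}" "A \<noteq> B" "Min A < Min B \<or> Min A = Min B \<and> Max A < Max B"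
          using less by auto
        have "Min A \<in> A" using A'(1) card_ge_0_finite[of A] by (intro Min_in) auto
        then have "Min A \<ge> 1" using A'(2) by auto
        \<comment> \<open>If \<open>Min B = 1\<close>, then \<open>Max A < Max B \<le> ?m\<close>.
          If \<open>Min B = 2\<close>, either \<open>Min A = 1\<close> or
          \<open>Max A < Max B \<le> b + 2\<close>.\<close>
        then have "Min A = 1 \<and> Min B = 2 \<or> A \<in> ?D"
          using Bc A'(1,4) unfolding shifted_edges_iff by linarith
        then consider "Min A = 1" "Min B = 2" | "A \<in> ?D" by blast
        then show "y \<in> fn.span (w ` (?D - {B}))"
        proof cases
          case 1
          have sub: "D1 \<subseteq> ?D - {B}" using D1 D1_min[of B] 1(2) by auto
          show ?thesis
            unfolding A(2) by (rule subsetD[OF fn.span_mono[OF image_mono[OF sub]] first[OF 1(1)]])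
        next
          case 2
          then show ?thesis unfolding A(2) using A'(3) by (intro fn.span_base imageI) simp
        qed
      qed
      then have sub: "fn.span (w ` ?L) \<subseteq> fn.span (w ` (?D - {B}))"
        by (rule fn.span_minimal) (rule fn.subspace_span)
      have "w ` (?D - {B}) = w ` ?D - {w B}" using inj True by (auto simp: inj_on_def)
      then have "w B \<notin> fn.span (w ` (?D - {B}))" using ind True unfolding fn.dependent_def by auto
      then show ?thesis using iff sub True by blast
    next
      case False
      have "w B \<in> fn.span (w ` ?L)"
      proof (cases "Min B = 1")
        case True
        have "D1 \<subseteq> ?L"
        proof
          fix A assume A: "A \<in> D1"
          then have "A \<in> ?D" using D1 by blast
          moreover from this have "Max A \<le> ?m" by (simp add: shifted_edges_iff)
          moreover have "Max B > ?m" using False True B(1) by (auto simp: shifted_edges_iff)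
          ultimately show "A \<in> ?L" using less Dsub D1_min[OF A] True by auto
        qed
        then show ?thesis using first[OF True] fn.span_mono[of "w ` D1" "w ` ?L"] by blast
      next
        case no1: False
        have "?D \<subseteq> ?L"
        proof
          fix A assume A: "A \<in> ?D"
          then have "Max A \<le> ?m" "Min A = 1 \<or> Min A = 2 \<and> Max A \<le> b + 2" by (simp_all add: shifted_edges_iff)
          \<comment> \<open>Outside \<open>?D\<close> and with minimum other than 1,
            \<open>B\<close> has minimum above 2, or minimum 2 and maximum above
            \<open>b + 2\<close>, as \<open>b + 2 \<le> ?m\<close>.\<close>
          then have "Min A < Min B \<or> Min A = Min B \<and> Max A < Max B"
            using False no1 rB(1) B(1) m(1) by (auto simp: shifted_edges_iff)
          then show "A \<in> ?L" using less Dsub[OF A] by blast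
        qed
        then show ?thesis using full[of B] fn.span_mono[of "w ` ?D" "w ` ?L"] by blast
      qed
      then show ?thesis using iff False by blast
    qed
  qed
  have in_quotient_low: "in_quotient_span n ?K (f_base n X B) (?low B) \<longleftrightarrow>
      (\<exists>s\<in>fn.span (?low B). \<forall>A\<in>?K. f_base n X B A = s A)" if B: "card B \<noteq> 0" for B
  proof (rule in_quotient_span_iff)
    have supp: "f_base n X A C = 0" if "card A = card B" "\<not> C \<subseteq> {1..n}" for A C
    proof -
      have "finite A" using that(1) B by (metis card.infinite)
      then show ?thesis using f_base_support(2)[of A n X C] that(2) by blast
    qed
    show "f_base n X B A = 0" if "\<not> A \<subseteq> {1..n}" for A by (rule supp[OF HOL.refl that])
    show "s A = 0" if "s \<in> ?low B" "\<not> A \<subseteq> {1..n}" for s A using that supp by blast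
  qed
  have single: "B \<in> exterior_shifting n X ?K" if B: "card B = 1" "B \<subseteq> {1..n}" for B
  proof -
    obtain j where j: "B = {j}" "j \<in> {1..n}" using B card_1_singletonE by blast
    have "\<not> in_quotient_span n ?K (f_base n X B) (?low B)"
    proof
      assume in_q: "in_quotient_span n ?K (f_base n X B) (?low B)"
      have "card B \<noteq> 0" using B(1) by simp
      from iffD1[OF in_quotient_low[OF this] in_q]
      obtain s where s: "s \<in> fn.span (?low B)" "\<forall>A\<in>?K. f_base n X B A = s A" by (rule bexE)
      have low: "?low B = (\<lambda>i. f_base n X {i}) ` {1..<j}"
      proof (intro equalityI subsetI)
        fix y assume "y \<in> ?low B"
        then obtain A where A: "A \<subseteq> {1..n}" "card A = 1" "lex_less A B" "y = f_base n X A" using B(1) by auto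
        then obtain i where i: "A = {i}" using card_1_singletonE by blast
        have "i < j" using A(3) unfolding lex_less_def i j(1) by (auto simp: min_def split: if_splits)
        then show "y \<in> (\<lambda>i. f_base n X {i}) ` {1..<j}" using A i by auto
      next
        fix y assume "y \<in> (\<lambda>i. f_base n X {i}) ` {1..<j}"
        then obtain i where i: "1 \<le> i" "i < j" "y = f_base n X {i}" by auto
        have "({i} - {j}) \<union> ({j} - {i}) = {i, j}" using i by auto
        then have "lex_less {i} B" using i unfolding lex_less_def j(1) by simp
        then show "y \<in> ?low B" using i j by (intro CollectI exI[of _ "{i}"]) auto
      qed
      have "\<exists>a. \<forall>p\<in>{1..n}. s {p} = (\<Sum>i\<in>{1..<j}. a i * X i p)"
        using s(1)[unfolded low]
      proof (induction rule: fn.span_induct_alt)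
        case base
        show ?case by (intro exI[of _ "\<lambda>_. 0"]) simp
      next
        case (step k x s)
        then obtain a i where a: "\<forall>p\<in>{1..n}. s {p} = (\<Sum>i\<in>{1..<j}. a i * X i p)"
          and i: "i \<in> {1..<j}" "x = f_base n X {i}" by blast
        have "(fscale k x + s) {p} = (\<Sum>l\<in>{1..<j}. (a l + (if l = i then k else 0)) * X l p)" if "p \<in> {1..n}" for p
          using a that i by (simp add: fscale_apply f_base_single distrib_right sum.distrib
              if_distrib[of "\<lambda>x. x * _"] cong: if_cong)
        then show ?case by (intro exI[of _ "\<lambda>l. a l + (if l = i then k else 0)"]) blast
      qed
      then obtain a where a: "\<forall>p\<in>{1..n}. s {p} = (\<Sum>i\<in>{1..<j}. a i * X i p)" by blast
      \<comment> \<open>Turns the representation of row \<open>j\<close> by earlier rows into a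
        linear relation among all rows with coefficient -1 at \<open>j\<close>.\<close>
      define a' where "a' = (\<lambda>i. if i = j then - 1 else if i < j then a i else 0)"
      have "(\<Sum>i\<in>{1..n}. a' i * X i p) = 0" if p: "p \<in> {1..n}" for p
      proof -
        have "{p} \<in> ?K" using p by (auto simp: graph_complex_def)
        then have Xj: "X j p = (\<Sum>i\<in>{1..<j}. a i * X i p)"
          using s(2) a p f_base_single[OF p, of X j] j(1) by auto
        have "(\<Sum>i\<in>{1..n}. a' i * X i p) = (\<Sum>i\<in>insert j {1..<j}. a' i * X i p)"
          using j(2) by (intro sum.mono_neutral_right) (auto simp: a'_def)
        also have "\<dots> = a' j * X j p + (\<Sum>i\<in>{1..<j}. a' i * X i p)" by simp
        also have "(\<Sum>i\<in>{1..<j}. a' i * X i p) = (\<Sum>i\<in>{1..<j}. a i * X i p)"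
          by (intro sum.cong) (auto simp: a'_def)
        finally show ?thesis using Xj by (simp add: a'_def)
      qed
      then have "a' j = 0" using rows[of a' j] j(2) by blast
      then show False by (simp add: a'_def)
    qed
    then show ?thesis using B by (simp add: exterior_shifting_def)
  qed
  have empty: "{} \<in> exterior_shifting n X ?K"
  proof -
    have low: "?low {} = {}"
    proof -
      have "A = {}" if "A \<subseteq> {1..n}" "card A = card {}" for A :: "nat set"
        using that finite_subset[of A "{1..n}"] by simp
      then show ?thesis by (auto simp: lex_less_def)
    qed
    have supp: "f_base n X {} C = 0" if "\<not> C \<subseteq> {1..n}" for C
      using f_base_support[of "{}" n X C] that by blast
    have "\<not> in_quotient_span n ?K (f_base n X {}) {}"
    proof
      assume "in_quotient_span n ?K (f_base n X {}) {}"
      then have "f_base n X {} {} = 0"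
        using in_quotient_span_iff[of n "f_base n X {}" "{}" ?K] supp by (auto simp: graph_complex_def)
      then show False by (simp add: f_base_def e_base_def)
    qed
    then show ?thesis unfolding exterior_shifting_def mem_Collect_eq low by simp
  qed
  \<comment> \<open>The coordinates of \<open>f_base n X B\<close> sit on sets of the size of
    \<open>B\<close>, none of which is a face, so its class is zero.\<close>
  have big: "B \<notin> exterior_shifting n X ?K" if B: "card B > 2" "B \<subseteq> {1..n}" for B
  proof -
    have "finite B" using B(2) finite_subset by blast
    have "f_base n X B A = 0" if "A \<in> ?K" for A
    proof -
      have "card A \<le> 2" using that fg by (auto simp: graph_complex_def finite_graph_def)
      then show ?thesis using f_base_support(3)[OF \<open>finite B\<close>, of n X A] B(1) by fastforce
    qed
    then have "\<forall>A\<in>?K. f_base n X B A = (0 :: nat set \<Rightarrow> 'f) A" by simp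
    moreover have "0 \<in> fn.span (?low B)" by (rule fn.span_zero)
    ultimately have "\<exists>s\<in>fn.span (?low B). \<forall>A\<in>?K. f_base n X B A = s A" by (rule bexI)
    moreover have "card B \<noteq> 0" using B(1) by simp
    ultimately have "in_quotient_span n ?K (f_base n X B) (?low B)" using in_quotient_low by simp
    then show ?thesis by (simp add: exterior_shifting_def)
  qed
  show ?thesis
  proof (rule Set.set_eqI)
    fix B
    have Delta: "B \<in> Delta_top b c n \<longleftrightarrow> B = {} \<or> (\<exists>v\<in>{1..n}. B = {v}) \<or> B \<in> ?D"
      unfolding Delta_top_def shifted_edges_def by auto
    show "B \<in> exterior_shifting n X ?K \<longleftrightarrow> B \<in> Delta_top b c n"
    proof (cases "B \<subseteq> {1..n}")
      case False
      have "B \<notin> ?D" using False m(2) unfolding shifted_edges_def by auto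
      then show ?thesis unfolding Delta using False by (auto simp: exterior_shifting_def)
    next
      case True
      then have "finite B" by (rule finite_subset) simp
      consider "B = {}" | "card B = 1" | "card B = 2" | "card B > 2"
        using \<open>finite B\<close> card_gt_0_iff[of B] by linarith
      then show ?thesis
      proof cases
        case 1
        then show ?thesis unfolding Delta using empty by blast
      next
        case 2
        then obtain v where "B = {v}" using card_1_singletonE by blast
        then show ?thesis unfolding Delta using single[OF 2 True] True by blast
      next
        case 3
        then have "B \<noteq> {}" "\<nexists>v. B = {v}" by auto
        then show ?thesis unfolding Delta using pair[OF 3 True] by blast
      next
        case 4
        then have "B \<noteq> {}" "\<nexists>v. B = {v}" "B \<notin> ?D" by (auto simp: shifted_edges_def)
        then show ?thesis unfolding Delta using big[OF 4 True] by blast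
      qed
    qed
  qed
qed

section \<open>Generic bases for refinements without old edges\<close>

lemma polyfun_edge_minor:
  assumes "is_subfield k" "e \<in> E" "Min e \<in> {1..n}" "Max e \<in> {1..n}" "i \<in> {1..n}" "j \<in> {1..n}"
  shows "polyfun k ({1..n} \<times> {1..n}) (\<lambda>x. edge_minor E (\<lambda>p. x (i, p)) (\<lambda>p. x (j, p)) e)"
proof -
  have "polyfun k ({1..n} \<times> {1..n}) (\<lambda>x. x (i, Min e) * x (j, Max e) - x (i, Max e) * x (j, Min e))"
    using assms(3-6) by (intro polyfun_diff polyfun_mult polyfun_var assms(1)) simp_all
  then show ?thesis using assms(2) by (simp add: edge_minor_def)
qed

lemma generic_exterior_shifting:
  fixes X :: "nat \<Rightarrow> nat \<Rightarrow> 'f::field"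
  assumes fg: "finite_graph {1..n} E" and rep: "component_rep {1..n} E r" and c: "c = card (r ` {1..n})"
    and b: "b + n = card E + c" "b + c + 1 \<le> n"
    and deg2: "\<And>e. e \<in> E \<Longrightarrow> \<exists>w u v. u \<noteq> v \<and> u \<noteq> w \<and> v \<noteq> w \<and> u \<in> {1..n} \<and> v \<in> {1..n} \<and> w \<in> e \<and>
        {f \<in> E. w \<in> f} = {{u, w}, {w, v}}"
    and k: "is_subfield k" and X: "generic_matrix k n X"
  shows "exterior_shifting n X (graph_complex ({1..n}, E)) = Delta_top b c n"
proof (rule exterior_shifting_eq[OF fg rep c b])
  let ?I = "{1..n} \<times> {1..n}"
  let ?X = "\<lambda>(i, j). X i j"
  note X = X[unfolded generic_matrix_def]
  have n: "1 \<in> {1..n}" using b(2) by simp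
  have fE: "finite E" using fg by (rule finite_graph_finite)
  show "X 1 i \<noteq> 0" if "i \<in> {1..n}" for i
  proof -
    have "polyfun k ?I (\<lambda>x. x (1, i))" using n that by (intro polyfun_var k) simp
    then show ?thesis using alg_independent_nonzero[OF k X, of "\<lambda>x. x (1, i)" "\<lambda>_. 1"] by simp
  qed
  \<comment> \<open>This row serves as the vector \<open>y\<close> of the specialisation: it
    supplies \<open>n\<close> distinct field elements even when \<open>k\<close> is finite.\<close>
  have inj: "inj_on (X 1) {1..n}"
  proof (rule inj_onI, rule ccontr)
    fix i j assume ij: "i \<in> {1..n}" "j \<in> {1..n}" "X 1 i = X 1 j" "i \<noteq> j"
    have "polyfun k ?I (\<lambda>x. x (1, i) - x (1, j))"
      using n ij by (intro polyfun_diff polyfun_var k) simp_all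
    then show False
      using alg_independent_nonzero[OF k X, of "\<lambda>x. x (1, i) - x (1, j)" "\<lambda>p. if p = (1, i) then 1 else 0"] ij
      by simp
  qed
  show "a i = 0" if a: "\<And>p. p \<in> {1..n} \<Longrightarrow> (\<Sum>i\<in>{1..n}. a i * X i p) = 0" and i: "i \<in> {1..n}" for a i
  \<comment> \<open>The special point is the identity matrix.\<close>
  proof (rule alg_independent_kernel[OF k, where D = "{1..n}" and T = "{1..n}" and I = ?I and
        w = "\<lambda>i p x. x (i, p)" and X = ?X and ?x0.0 = "\<lambda>(i, j). if i = j then 1 else 0"])
    show "polyfun k ?I (\<lambda>x. x (d, t))" if "d \<in> {1..n}" "t \<in> {1..n}" for d t
      using that by (intro polyfun_var k) simp
    show "z t = 0" if z: "\<And>d. d \<in> {1..n} \<Longrightarrow> (\<Sum>t\<in>{1..n}. z t * (case (d, t) of (i, j) \<Rightarrow> if i = j then 1 else 0)) = 0"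
      and t: "t \<in> {1..n}" for z :: "nat \<Rightarrow> 'f" and t
      using z[OF t] t by (simp add: if_distrib[of "\<lambda>x. _ * x"] cong: if_cong)
  qed (use a i X in simp_all)
  let ?m = "n - c + 1"
  let ?D = "shifted_edges ?m b"
  have m: "b + 2 \<le> ?m" using b(2) by simp
  have D_in: "Min A \<in> {1..n}" "Max A \<in> {1..n}" if "A \<in> ?D" for A
  proof -
    have "r ` {1..n} \<noteq> {}" using n by blast
    then have "c > 0" unfolding c by (simp add: card_gt_0_iff)
    then have "?m \<le> n" using b(2) by simp
    moreover have "Max A \<le> ?m" "Min A \<ge> 1" "card A = 2" using that by (auto simp: shifted_edges_iff)
    ultimately show "Min A \<in> {1..n}" "Max A \<in> {1..n}" using card_2_Min_Max(2)[of A] by auto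
  qed
  have "z = 0" if z: "z \<in> cycle_space E" "\<forall>v. contract E z (X 1) v = 0" for z :: "nat set \<Rightarrow> 'f"
  proof
    fix e
    show "z e = 0 e"
    proof (cases "e \<in> E")
      case True
      then obtain w u v where w: "u \<noteq> v" "u \<noteq> w" "v \<noteq> w" "u \<in> {1..n}" "v \<in> {1..n}" "w \<in> e"
        "{f \<in> E. w \<in> f} = {{u, w}, {w, v}}"
        using deg2 by blast
      \<comment> \<open>Only the two edges at \<open>w\<close> contribute, with a sign telling
        whether \<open>w\<close> is the larger endpoint. The constant vector and \<open>X 1\<close>
        give two equations for two unknowns.\<close>
      have eq: "z {u, w} * (if u < w then 1 else - 1) * f u + z {w, v} * (if v < w then 1 else - 1) * f v = contract E z f w"
        for f :: "nat \<Rightarrow> 'f"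
      proof -
        have "contract E z f w = (\<Sum>e\<in>{f \<in> E. w \<in> f}. z e * (f (Min e) * delta w (Max e) - f (Max e) * delta w (Min e)))"
          unfolding contract_def pairing_def
        proof (rule sum.mono_neutral_right)
          show "\<forall>e\<in>E - {f \<in> E. w \<in> f}. z e * (f (Min e) * delta w (Max e) - f (Max e) * delta w (Min e)) = 0"
          proof
            fix e' assume e': "e' \<in> E - {f \<in> E. w \<in> f}"
            then have "e' \<in> E" by blast
            from finite_graph_edge(4)[OF fg this] e' have "w \<noteq> Min e'" "w \<noteq> Max e'" by auto
            then show "z e' * (f (Min e') * delta w (Max e') - f (Max e') * delta w (Min e')) = 0"
              by (simp add: delta_def)
          qed
        qed (use fE in auto)
        moreover have "{u, w} \<noteq> {w, v}" using w by (auto simp: doubleton_eq_iff)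
        ultimately show ?thesis using w(1-3) by (auto simp: w(7) delta_def min_def max_def)
      qed
      define \<alpha> \<beta> where "\<alpha> = z {u, w} * (if u < w then 1 else - 1)" and "\<beta> = z {w, v} * (if v < w then 1 else - 1)"
      have "contract E z (\<lambda>_. 1) w = 0" using z(1) by (simp add: cycle_space_def)
      then have 1: "\<alpha> + \<beta> = 0" using eq[of "\<lambda>_. 1"] by (simp add: \<alpha>_def \<beta>_def)
      have 2: "\<alpha> * X 1 u + \<beta> * X 1 v = 0" using eq[of "X 1"] z(2) by (simp add: \<alpha>_def \<beta>_def)
      have "\<beta> = - \<alpha>" using 1 by (simp add: eq_neg_iff_add_eq_0 add.commute)
      then have "\<alpha> * (X 1 u - X 1 v) = 0" using 2 by (simp add: algebra_simps)
      moreover have "X 1 u \<noteq> X 1 v" using inj_on_eq_iff[OF inj w(4,5)] w(1) by simp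
      ultimately have "\<alpha> = 0" "\<beta> = 0" using \<open>\<beta> = - \<alpha>\<close> by auto
      then have "z {u, w} = 0" "z {w, v} = 0" by (auto simp: \<alpha>_def \<beta>_def split: if_splits)
      moreover have "e \<in> {{u, w}, {w, v}}" using True w(6,7) by blast
      ultimately show ?thesis by auto
    qed (use z(1) in \<open>simp add: cycle_space_def\<close>)
  qed
  moreover have "E \<noteq> {}" using b by auto
  moreover have "b + card {1..n} = card E + card (r ` {1..n})" "b + card (r ` {1..n}) + 1 \<le> card {1..n}"
    using b c by simp_all
  ultimately have "\<exists>F :: nat \<Rightarrow> nat \<Rightarrow> 'f. \<forall>z. (\<forall>e. e \<notin> E \<longrightarrow> z e = 0) \<longrightarrow>
    (\<forall>j\<in>{2..card {1..n} - card (r ` {1..n}) + 1}. pairing E z (F 1) (F j) = 0) \<longrightarrow>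
    (\<forall>j\<in>{3..b + 2}. pairing E z (F 2) (F j) = 0) \<longrightarrow> z = 0"
    by (intro ex_specialisation[OF fg _ rep _ _ inj])
  then obtain F :: "nat \<Rightarrow> nat \<Rightarrow> 'f" where "\<forall>z. (\<forall>e. e \<notin> E \<longrightarrow> z e = 0) \<longrightarrow>
    (\<forall>j\<in>{2..card {1..n} - card (r ` {1..n}) + 1}. pairing E z (F 1) (F j) = 0) \<longrightarrow>
    (\<forall>j\<in>{3..b + 2}. pairing E z (F 2) (F j) = 0) \<longrightarrow> z = 0"
    by (rule exE)
  then have F: "z = 0" if "\<forall>e. e \<notin> E \<longrightarrow> z e = 0" "\<forall>j\<in>{2..?m}. pairing E z (F 1) (F j) = 0"
    "\<forall>j\<in>{3..b + 2}. pairing E z (F 2) (F j) = 0" for z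
    using that c by simp
  show "a A = 0" if a: "\<And>e. e \<in> E \<Longrightarrow> (\<Sum>A\<in>?D. a A * edge_minor E (X (Min A)) (X (Max A)) e) = 0" and A: "A \<in> ?D" for a A
  \<comment> \<open>Rows are the claimed pairs and columns the edges. At \<open>F\<close> the kernel
    consists of the weights whose pairings all vanish.\<close>
  proof (rule alg_independent_kernel[OF k, where D = ?D and T = E and I = ?I and
        w = "\<lambda>A e x. edge_minor E (\<lambda>p. x (Min A, p)) (\<lambda>p. x (Max A, p)) e" and X = ?X and ?x0.0 = "\<lambda>(i, j). F i j"])
    show "finite ?D" "card ?D = card E" using card_shifted_edges[OF m] b by simp_all
    show "polyfun k ?I (\<lambda>x. edge_minor E (\<lambda>p. x (Min A, p)) (\<lambda>p. x (Max A, p)) e)" if "A \<in> ?D" "e \<in> E" for A e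
      by (rule polyfun_edge_minor[OF k that(2) _ _ D_in[OF that(1)]]) (use finite_graph_edge[OF fg that(2)] in auto)
    show "z e = 0" if z: "\<And>A. A \<in> ?D \<Longrightarrow> (\<Sum>e\<in>E. z e *
        edge_minor E (\<lambda>p. case (Min A, p) of (i, j) \<Rightarrow> F i j) (\<lambda>p. case (Max A, p) of (i, j) \<Rightarrow> F i j) e) = 0"
      and e: "e \<in> E" for z e
    proof -
      \<comment> \<open>Extension by zero, since the property of \<open>F\<close> concerns weights
        supported on \<open>E\<close>.\<close>
      define z' where "z' = (\<lambda>e. if e \<in> E then z e else 0)"
      have pz: "pairing E z' (F i) (F j) = 0" if "{i, j} \<in> ?D" "i < j" for i j
      proof -
        have "Min {i, j} = i" "Max {i, j} = j" using that(2) by auto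
        then show ?thesis using z[OF that(1)] by (simp add: pairing_def z'_def edge_minor_def)
      qed
      have "z' = 0"
      proof (rule F)
        show "\<forall>e. e \<notin> E \<longrightarrow> z' e = 0" by (simp add: z'_def)
        show "\<forall>j\<in>{2..?m}. pairing E z' (F 1) (F j) = 0"
        proof
          fix j assume j: "j \<in> {2..?m}"
          then have "{1, j} \<in> ?D" unfolding shifted_edges_eq[OF m] by blast
          then show "pairing E z' (F 1) (F j) = 0" using j by (intro pz) auto
        qed
        show "\<forall>j\<in>{3..b + 2}. pairing E z' (F 2) (F j) = 0"
        proof
          fix j assume j: "j \<in> {3..b + 2}"
          then have "{2, j} \<in> ?D" unfolding shifted_edges_eq[OF m] by blast
          then show "pairing E z' (F 2) (F j) = 0" using j by (intro pz) auto
        qed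
      qed
      then have "z' e = 0" by simp
      then show ?thesis using e by (simp add: z'_def)
    qed
  qed (use a A X fE in simp_all)
qed

section \<open>The limit over random refinements\<close>

theorem theorem1p3:
  fixes V :: "nat set" and E :: "nat set set"
    and b c :: nat
    and k :: "'f::field set"
    and X :: "nat \<Rightarrow> nat \<Rightarrow> nat \<Rightarrow> 'f"
  assumes "finite_graph V E" and "V \<subseteq> {1..}" and "E \<noteq> {}"
    and "c = num_components V E" and "b = betti1 V E"
    and "is_subfield k" and "\<And>n. generic_matrix k n (X n)"
  shows "(\<lambda>n. measure_pmf.prob (pmf_of_set (refinements_on (V, E) n))
            {H. exterior_shifting n (X n) (graph_complex H) = Delta_top b c n})
         \<longlonglongrightarrow> 1"
proof -
  let ?R = "\<lambda>n. refinements_on (V, E) n"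
  let ?S = "\<lambda>n. {H. exterior_shifting n (X n) (graph_complex H) = Delta_top b c n}"
  let ?p = "\<lambda>n. measure_pmf.prob (pmf_of_set (?R n))"
  have fV: "finite V" and fE: "finite E"
    using assms(1) finite_graph_finite by (auto simp: finite_graph_def)
  obtain r where r: "component_rep V E r"
    using cycle_space_basis[OF assms(1), where 'f = rat] by blast
  have c: "c = card (r ` V)" using num_components_eq[OF r] assms(4) by simp
  have b: "b + card V = card E + c" using betti1_eq[OF assms(1) r] assms(5) c by simp
  \<comment> \<open>The bound on \<open>n\<close> amounts to \<open>b + 2 \<le> n - c + 1\<close>,
    which leaves room for every pair \<open>{2, j}\<close> with
    \<open>j \<le> b + 2\<close>.\<close>
  have good: "H \<in> ?S n" if n: "b + c + 1 \<le> n" and H: "H \<in> ?R n" and old: "\<forall>e\<in>E. e \<notin> snd H" for n H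
  proof -
    have ref: "refinement (V, E) H" and fst: "fst H = {1..n}" using H by (simp_all add: refinements_on_def)
    obtain E' where H': "H = ({1..n}, E')" using fst by (cases H) simp
    have fg: "finite_graph {1..n} E'" using refinement_finite_graph[OF assms(1) ref] H' by simp
    obtain r' where r': "component_rep {1..n} E' r'" "r' ` {1..n} = r ` V"
      using refinement_component_rep[OF assms(1) ref r] H' by auto
    have bn: "b + n = card E' + c"
      using refinement_card_edges[OF assms(1) ref] b H' by simp
    have "exterior_shifting n (X n) (graph_complex ({1..n}, E')) = Delta_top b c n"
    proof (rule generic_exterior_shifting[OF fg r'(1) _ bn n _ assms(6,7)])
      show "c = card (r' ` {1..n})" using c r'(2) by simp
      show "\<exists>w u v. u \<noteq> v \<and> u \<noteq> w \<and> v \<noteq> w \<and> u \<in> {1..n} \<and> v \<in> {1..n} \<and> w \<in> e \<and> {f \<in> E'. w \<in> f} = {{u, w}, {w, v}}"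
        if e: "e \<in> E'" for e
      proof -
        have "\<not> e \<subseteq> V"
          using refinement_old_edge[OF assms(1) ref, of e] old e H' by auto
        then obtain w where w: "w \<in> e" "w \<notin> V" by blast
        have "e \<subseteq> {1..n}" using e fg by (simp add: finite_graph_def)
        then have "w \<in> fst H" using w(1) unfolding fst by blast
        then show ?thesis using refinement_new_vertex_edges[OF assms(1) ref _ w(2)] w(1) H' by auto
      qed
    qed
    then show ?thesis using H' by simp
  qed
  have ne: "\<forall>\<^sub>F n in sequentially. ?R n \<noteq> {}"
    using eventually_ge_at_top[of "Max (insert 0 V)"]
  proof eventually_elim
    case (elim n)
    then have "V \<subseteq> {1..n}" using assms(2) fV by auto
    then show ?case using ex_refinement[OF assms(1) _ _ assms(3), of "{1..n}"] by (auto simp: refinements_on_def)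
  qed
  \<comment> \<open>Union bound: within the support, the shifting can differ from
    \<open>Delta_top b c n\<close> only if some original edge survives.\<close>
  have lower: "\<forall>\<^sub>F n in sequentially. 1 - (\<Sum>e\<in>E. ?p n {H. e \<in> snd H}) \<le> ?p n (?S n)"
    using ne eventually_ge_at_top[of "b + c + 1"]
  proof eventually_elim
    case (elim n)
    let ?B = "\<Union>e\<in>E. {H. e \<in> snd H}"
    have set: "set_pmf (pmf_of_set (?R n)) = ?R n"
      using elim(1) finite_refinements_on[OF assms(1)] by simp
    have "AE H in measure_pmf (pmf_of_set (?R n)). H \<in> ?S n \<union> ?B"
      unfolding AE_measure_pmf_iff set using good[OF elim(2)] by blast
    then have "1 = ?p n (?S n \<union> ?B)"
      by (intro measure_pmf.prob_eq_1[THEN iffD2, symmetric]) simp_all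
    also have "\<dots> \<le> ?p n (?S n) + ?p n ?B"
      by (rule measure_Un_le) simp_all
    also have "?p n ?B \<le> (\<Sum>e\<in>E. ?p n {H. e \<in> snd H})"
      using fE by (intro measure_pmf.finite_measure_subadditive_finite) auto
    finally show ?case by simp
  qed
  have "(\<lambda>n. 1 - (\<Sum>e\<in>E. ?p n {H. e \<in> snd H})) \<longlonglongrightarrow> 1 - (\<Sum>e\<in>E. 0)"
    by (intro tendsto_intros tendsto_prob_edge_survives assms)
  then have lim: "(\<lambda>n. 1 - (\<Sum>e\<in>E. ?p n {H. e \<in> snd H})) \<longlonglongrightarrow> 1" by simp
  show ?thesis
    by (rule tendsto_sandwich[OF lower _ lim tendsto_const]) simp
qed

end
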